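(* Let $N\ge3$ and let $(u_1,\dots,u_N)$ be the solution of the $N$-layered transmission problem described in the context, whose data satisfy $f_j=g_j=0$ for $t\le t_0$, $j=1,\dots,N-1$. Let $M\in\mathbb{N}$ with $M\ge2$, and define $$T(M)=t_0+M\min_{1\le j\le N-2}c_{j+1}^{-1}d_{j,j+1}.$$ Let $\widetilde u_1^M,\dots,\widetilde u_N^M$ be the $M$-th order additive multiple-scattering sums defined in the context. Then $$u_j(\bm x,t)=\widetilde u_j^M(\bm x,t)\quad\text{for }(\bm x,t)\in\Omega_j\times[0,T(M)],\quad j=1,\dots,N.$$
   Context: Geometry. $\mathbb{R}^2$ is divided into $N$ layers $\Omega_1,\dots,\Omega_N$, numbered from top to bottom, by $N-1$ pairwise disjoint unbounded Lipschitz interfaces $\Gamma_1,\dots,\Gamma_{N-1}$, each a local perturbation of a flat horizontal line; $\Gamma_j$ separates $\Omega_j$ (above) from $\Omega_{j+1}$ (below). The unit normal $\bm n$ on $\Gamma_j$ points from $\Omega_{j+1}$ into $\Omega_j$. Set $d_{j,j+1}=\mathrm{dist}(\Gamma_j,\Gamma_{j+1})$ for $j=1,\dots,N-2$ (the layer between $\Gamma_j$ and $\Gamma_{j+1}$ is $\Omega_{j+1}$), and assume $\min_jd_{j,j+1}>0$. Layer $\Omega_j$ has constant wave speed $c_j>0$ and constant density $\rho_j>0$. Write $\mathbb{R}^+=\{t\in\mathbb{R}:t>0\}$, and let $t_0>0$ be the arrival time of the incident field at the interfaces. $N$-layered transmission problem: find $u_j$ on $\Omega_j\times\mathbb{R}^+$,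 $j=1,\dots,N$, with $$\partial_t^2u_j-c_j^2\Delta u_j=0\ \text{ in }\Omega_j\times\mathbb{R}^+,\qquad u_j|_{t=0}=\partial_tu_j|_{t=0}=0\ \text{ in }\Omega_j,$$ and, for $j=1,\dots,N-1$, on $\Gamma_j\times\mathbb{R}^+$, $$u_{j+1}-u_j=f_j,\qquad \rho_{j+1}^{-1}\frac{\partial u_{j+1}}{\partial\bm n}-\rho_j^{-1}\frac{\partial u_j}{\partial\bm n}=g_j.$$ The data come from a smooth incident field: for a plane wave $u^{\mathrm{inc}}$ impinging on $\Gamma_1$, $f_j=\delta_{j,1}u^{\mathrm{inc}}$ and $g_j=\delta_{j,1}\rho_1^{-1}\partial u^{\mathrm{inc}}/\partial\bm n$; for a point source $u^{\mathrm{inc}}$ located in $\Omega_{j_0}$, $f_j=(\delta_{j,j_0}-\delta_{j+1,j_0})u^{\mathrm{inc}}$ and $g_j=(\rho_j^{-1}\delta_{j,j_0}-\rho_{j+1}^{-1}\delta_{j+1,j_0})\partial u^{\mathrm{inc}}/\partial\bm n$ ($\delta$ the Kronecker delta). Two-layered problem for $\Gamma_j$ ($1\le j\le N-1$) with data $(\widetilde f,\widetilde g)$: let $\widetilde\Omega_j^{+}$ and $\widetilde\Omega_{j+1}^{-}$ be the unbounded domains lying above and below $\Gamma_j$, respectively. Find $\widetilde u_j^+$ on $\widetilde\Omega_j^+\times\mathbb{R}^+$ and $\widetilde u_{j+1}^-$ on $\widetilde\Omega_{j+1}^-\times\mathbb{R}^+$ with $$\partial_t^2\widetilde u_j^+-c_j^2\Delta\widetilde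 u_j^+=0\ \text{in }\widetilde\Omega_j^+\times\mathbb{R}^+,\qquad \partial_t^2\widetilde u_{j+1}^--c_{j+1}^2\Delta\widetilde u_{j+1}^-=0\ \text{in }\widetilde\Omega_{j+1}^-\times\mathbb{R}^+,$$ $$\widetilde u_{j+1}^--\widetilde u_j^+=\widetilde f,\qquad \rho_{j+1}^{-1}\frac{\partial\widetilde u_{j+1}^-}{\partial\bm n}-\rho_j^{-1}\frac{\partial\widetilde u_j^+}{\partial\bm n}=\widetilde g\quad\text{on }\Gamma_j\times\mathbb{R}^+,$$ and zero initial values and zero initial time derivatives for both functions. Solutions of all the transmission problems above are assumed to exist, in a class in which each problem has at most one solution. Additive multiple scattering. For $m\in\mathbb{N}=\{1,2,\dots\}$ and $j=1,\dots,N-1$ let $(\widetilde u_{j,m}^+,\widetilde u_{j+1,m}^-)$ be the solution of the two-layered problem for $\Gamma_j$ with data $(\widetilde f_{j,m},\widetilde g_{j,m})$ on $\Gamma_j$ given inductively by $(\widetilde f_{j,1},\widetilde g_{j,1})=(f_j,g_j)$ and, for $m\ge2$, $$\widetilde f_{j,m}=(1-\delta_{1,j})\widetilde u_{j,m-1}^--(1-\delta_{N,j+1})\widetilde u_{j+1,m-1}^+,$$ $$\widetilde g_{j,m}=(1-\delta_{1,j})\rho_j^{-1}\frac{\partial\widetilde u_{j,m-1}^-}{\partial\bm n}-(1-\delta_{N,j+1})\rho_{j+1}^{-1}\frac{\partial\widetilde u_{j+1,m-1}^+}{\partial\bm n}.$$ The $M$-th order sums are, restricted to $\Omega_j$, $$\widetilde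 u_j^M=\sum_{m=1}^M\left((1-\delta_{1,j})\widetilde u_{j,m}^-+(1-\delta_{N,j})\widetilde u_{j,m}^+\right),\qquad j=1,\dots,N.$$ Terms multiplied by a vanishing factor (involving the undefined $\widetilde u_{1,m}^-$ or $\widetilde u_{N,m}^+$) are omitted.
   Formalization: The solution class is taken to be closed under sums and under restriction from the two-layered domains to the layers, and each problem is assumed to have at most one (classical, C^2) solution in it on every initial time interval (0,T), not only on all positive times. *)

theory Defs
  imports "HOL-Analysis.Analysis"
begin

type_synonym plane = "real \<times> real"

section \<open>Calculus\<close>

text \<open>Meant for open \<open>S\<close>: all directional derivatives up to order \<open>k\<close> exist and are
  continuous, i.e. \<open>f\<close> is of class C^k on \<open>S\<close>.\<close>

primrec Ck_on :: "nat \<Rightarrow> 'a::euclidean_space set \<Rightarrow> ('a \<Rightarrow> real) \<Rightarrow> bool" where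
  "Ck_on 0 S f \<longleftrightarrow> continuous_on S f"
| "Ck_on (Suc k) S f \<longleftrightarrow>
     f differentiable_on S \<and> (\<forall>v. Ck_on k S (\<lambda>x. frechet_derivative f (at x) v))"

definition smooth_on :: "'a::euclidean_space set \<Rightarrow> ('a \<Rightarrow> real) \<Rightarrow> bool" where
  "smooth_on S f \<longleftrightarrow> (\<forall>k. Ck_on k S f)"

definition laplacian :: "(plane \<Rightarrow> real) \<Rightarrow> plane \<Rightarrow> real" where
  "laplacian \<phi> x =
     (\<Sum>i\<in>Basis. frechet_derivative (\<lambda>y. frechet_derivative \<phi> (at y) i) (at x) i)"

definition wave_equation ::
  "plane set \<Rightarrow> real set \<Rightarrow> real \<Rightarrow> (plane \<Rightarrow> real \<Rightarrow> real) \<Rightarrow> bool" where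
  "wave_equation D J c u \<longleftrightarrow>
     (\<forall>x\<in>D. \<forall>t\<in>J. deriv (deriv (u x)) t - c\<^sup>2 * laplacian (\<lambda>y. u y t) x = 0)"


section \<open>Interfaces\<close>

text \<open>An unbounded Lipschitz curve: near each of its points it is, after a rotation or reflection,
  the graph of a Lipschitz function, and outside a disc it is the horizontal line at height \<open>h\<close>.
  It need not be a graph over the horizontal axis.\<close>

definition lipschitz_interface :: "real \<Rightarrow> plane set \<Rightarrow> bool" where
  "lipschitz_interface h \<Gamma> \<longleftrightarrow>
     closed \<Gamma> \<and> connected \<Gamma> \<and>
     (\<exists>R. \<forall>x. R < norm x \<longrightarrow> (x \<in> \<Gamma> \<longleftrightarrow> snd x = h)) \<and>
     (\<forall>p\<in>\<Gamma>. \<exists>Q \<phi> L r. orthogonal_transformation Q \<and> lipschitz_on L UNIV (\<phi> :: real \<Rightarrow> real) \<and>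
        0 < r \<and> (\<forall>y\<in>ball p r. y \<in> \<Gamma> \<longleftrightarrow> snd (Q y) = \<phi> (fst (Q y))))"

text \<open>The components of the complement of an interface that contain all points of the vertical
  axis which are sufficiently far up, respectively down.\<close>

definition upper_domain :: "plane set \<Rightarrow> plane set" where
  "upper_domain \<Gamma> = {x. \<exists>K. \<forall>s\<ge>K. connected_component (- \<Gamma>) x (0, s)}"

definition lower_domain :: "plane set \<Rightarrow> plane set" where
  "lower_domain \<Gamma> = {x. \<exists>K. \<forall>s\<ge>K. connected_component (- \<Gamma>) x (0, - s)}"

text \<open>Since the interfaces are disjoint and connected, the order of the heights of their flat parts
  is the order of the interfaces from top to bottom.\<close>

definition layered_geometry :: "nat \<Rightarrow> (nat \<Rightarrow> plane set) \<Rightarrow> bool" where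
  "layered_geometry N \<Gamma> \<longleftrightarrow>
     (\<exists>h. (\<forall>j\<in>{1..N-1}. lipschitz_interface (h j) (\<Gamma> j)) \<and>
          (\<forall>i\<in>{1..N-1}. \<forall>j\<in>{1..N-1}. i < j \<longrightarrow> h j < h i)) \<and>
     (\<forall>i\<in>{1..N-1}. \<forall>j\<in>{1..N-1}. i \<noteq> j \<longrightarrow> \<Gamma> i \<inter> \<Gamma> j = {}) \<and>
     (\<forall>j\<in>{1..N-2}. 0 < setdist (\<Gamma> j) (\<Gamma> (j+1)))"

definition layer :: "nat \<Rightarrow> (nat \<Rightarrow> plane set) \<Rightarrow> nat \<Rightarrow> plane set" where
  "layer N \<Gamma> j = (if j = 1 then UNIV else lower_domain (\<Gamma> (j-1))) \<inter>
                 (if j = N then UNIV else upper_domain (\<Gamma> j))"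

text \<open>\<open>n\<close> is normal to the boundary of \<open>D\<close> at \<open>x\<close> and points into \<open>D\<close>: close to \<open>x\<close>, every cone
  around \<open>n\<close> of opening less than \<open>\<pi>\<close> lies in \<open>D\<close>, and the opposite cone outside of \<open>D\<close>. On a
  Lipschitz interface this determines \<open>n\<close> at almost every point.\<close>

definition inward_unit_normal :: "plane set \<Rightarrow> plane \<Rightarrow> plane \<Rightarrow> bool" where
  "inward_unit_normal D x n \<longleftrightarrow> norm n = 1 \<and>
     (\<forall>\<epsilon>>0. \<exists>\<delta>>0. \<forall>y\<in>ball x \<delta>. (\<epsilon> * norm (y - x) < n \<bullet> (y - x) \<longrightarrow> y \<in> D) \<and>
                              (n \<bullet> (y - x) < - \<epsilon> * norm (y - x) \<longrightarrow> y \<notin> D))"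

text \<open>The unit normal of an interface, pointing upwards (from the lower into the upper domain);
  it is set to 0 at the exceptional points without a normal.\<close>

definition unit_normal :: "plane set \<Rightarrow> plane \<Rightarrow> plane" where
  "unit_normal \<Gamma> x =
     (if \<exists>n. inward_unit_normal (upper_domain \<Gamma>) x n
      then THE n. inward_unit_normal (upper_domain \<Gamma>) x n else 0)"

definition normal_deriv ::
  "plane set \<Rightarrow> (plane \<Rightarrow> real \<Rightarrow> real) \<Rightarrow> plane \<Rightarrow> real \<Rightarrow> real" where
  "normal_deriv \<Gamma> u x t = frechet_derivative (\<lambda>y. u y t) (at x) (unit_normal \<Gamma> x)"

text \<open>Sets of vanishing one-dimensional Hausdorff measure; on an interface, these are the null sets
  of arc length. (Boundedness is required because \<open>diameter\<close> is unspecified on unbounded sets.)\<close>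

definition arclength_null :: "plane set \<Rightarrow> bool" where
  "arclength_null Z \<longleftrightarrow>
     (\<forall>\<epsilon>>0. \<exists>B :: nat \<Rightarrow> plane set. Z \<subseteq> (\<Union>i. B i) \<and> (\<forall>i. bounded (B i)) \<and>
        (\<Sum>i. ennreal (diameter (B i))) < ennreal \<epsilon>)"


section \<open>Transmission problems\<close>

text \<open>Limits at a boundary point \<open>x\<close> of the open set \<open>D\<close> through all nontangential approach
  regions, the usual meaning of boundary values of a function and its gradient on Lipschitz domains.\<close>

definition nt_limit :: "plane set \<Rightarrow> plane \<Rightarrow> (plane \<Rightarrow> real) \<Rightarrow> real \<Rightarrow> bool" where
  "nt_limit D x \<phi> l \<longleftrightarrow>
     (\<forall>\<kappa>>0. (\<phi> \<longlongrightarrow> l) (at x within {y\<in>D. dist y x < (1 + \<kappa>) * infdist y (- D)}))"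

text \<open>The jump conditions across \<open>\<Gamma>\<close>, for \<open>ua\<close> on the domain \<open>A\<close> on the upper side of \<open>\<Gamma>\<close> and \<open>ub\<close>
  on the domain \<open>B\<close> on its lower side, with densities \<open>\<rho>a\<close> and \<open>\<rho>b\<close>. On a Lipschitz interface the
  normal derivatives only make sense almost everywhere.\<close>

definition transmission_conditions where
  "transmission_conditions (\<Gamma> :: plane set) J A \<rho>a ua B \<rho>b ub f g \<longleftrightarrow>
     (\<forall>t\<in>J. \<exists>Z. arclength_null Z \<and> (\<forall>x\<in>\<Gamma> - Z. \<exists>a b a' b'.
        nt_limit A x (\<lambda>y. ua y t) a \<and>
        nt_limit B x (\<lambda>y. ub y t) b \<and>
        nt_limit A x (\<lambda>y. frechet_derivative (\<lambda>z. ua z t) (at y) (unit_normal \<Gamma> x)) a' \<and>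
        nt_limit B x (\<lambda>y. frechet_derivative (\<lambda>z. ub z t) (at y) (unit_normal \<Gamma> x)) b' \<and>
        b - a = f x (t :: real) \<and>
        b' / \<rho>b - a' / \<rho>a = (g x t :: real)))"

text \<open>Classical solutions of the wave equation with zero initial values, belonging to the solution
  class \<open>X\<close> (which assigns a set of functions to each domain). The time set \<open>J\<close> is \<open>{0<..}\<close>, or
  \<open>{0<..<T}\<close> for the problem restricted to a finite time interval.\<close>

definition wave_ivp where
  "wave_ivp X D J c u \<longleftrightarrow>
     u \<in> X D \<and> Ck_on 2 (D \<times> J) (\<lambda>p. u (fst p) (snd p)) \<and> wave_equation D J c u \<and>
     (\<forall>x\<in>D. u x 0 = 0 \<and> (u x has_real_derivative 0) (at 0 within {0..}))"

definition layered_problem where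
  "layered_problem X N \<Gamma> c \<rho> J f g u \<longleftrightarrow>
     (\<forall>j\<in>{1..N}. wave_ivp X (layer N \<Gamma> j) J (c j) (u j)) \<and>
     (\<forall>j\<in>{1..N-1}. transmission_conditions (\<Gamma> j) J
        (layer N \<Gamma> j) (\<rho> j) (u j) (layer N \<Gamma> (j+1)) (\<rho> (j+1)) (u (j+1)) (f j) (g j))"

definition two_layered_problem where
  "two_layered_problem X \<Gamma> c \<rho> j J f g up um \<longleftrightarrow>
     wave_ivp X (upper_domain (\<Gamma> j)) J (c j) up \<and>
     wave_ivp X (lower_domain (\<Gamma> j)) J (c (j+1)) um \<and>
     transmission_conditions (\<Gamma> j) J
       (upper_domain (\<Gamma> j)) (\<rho> j) up (lower_domain (\<Gamma> j)) (\<rho> (j+1)) um f g"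

text \<open>A class of functions in which the problems are considered: closed under finite sums and under
  restriction to the layers, and such that each problem, posed on any initial time interval, has at
  most one solution in the class. (As solutions on all positive times restrict to solutions on each
  \<open>{0<..<T}\<close>, uniqueness for all positive times is included.)\<close>

definition uniqueness_class ::
  "nat \<Rightarrow> (nat \<Rightarrow> plane set) \<Rightarrow> (nat \<Rightarrow> real) \<Rightarrow> (nat \<Rightarrow> real) \<Rightarrow>
   (plane set \<Rightarrow> (plane \<Rightarrow> real \<Rightarrow> real) set) \<Rightarrow> bool" where
  "uniqueness_class N \<Gamma> c \<rho> X \<longleftrightarrow>
     (\<forall>D. (\<lambda>x t. 0) \<in> X D \<and> (\<forall>u\<in>X D. \<forall>v\<in>X D. (\<lambda>x t. u x t + v x t) \<in> X D)) \<and>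
     (\<forall>j\<in>{1..N-1}. X (upper_domain (\<Gamma> j)) \<subseteq> X (layer N \<Gamma> j) \<and>
                   X (lower_domain (\<Gamma> j)) \<subseteq> X (layer N \<Gamma> (j+1))) \<and>
     (\<forall>T>0. \<forall>f g u v.
        layered_problem X N \<Gamma> c \<rho> {0<..<T} f g u \<longrightarrow>
        layered_problem X N \<Gamma> c \<rho> {0<..<T} f g v \<longrightarrow>
        (\<forall>j\<in>{1..N}. \<forall>x\<in>layer N \<Gamma> j. \<forall>t\<in>{0<..<T}. u j x t = v j x t)) \<and>
     (\<forall>T>0. \<forall>j\<in>{1..N-1}. \<forall>f g up um vp vm.
        two_layered_problem X \<Gamma> c \<rho> j {0<..<T} f g up um \<longrightarrow>
        two_layered_problem X \<Gamma> c \<rho> j {0<..<T} f g vp vm \<longrightarrow>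
        (\<forall>x\<in>upper_domain (\<Gamma> j). \<forall>t\<in>{0<..<T}. up x t = vp x t) \<and>
        (\<forall>x\<in>lower_domain (\<Gamma> j). \<forall>t\<in>{0<..<T}. um x t = vm x t))"


section \<open>Incident fields\<close>

definition plane_wave :: "real \<Rightarrow> (plane \<Rightarrow> real \<Rightarrow> real) \<Rightarrow> bool" where
  "plane_wave c w \<longleftrightarrow>
     (\<exists>F d. smooth_on UNIV F \<and> norm d = 1 \<and> snd d < 0 \<and> w = (\<lambda>x t. F (t - (d \<bullet> x) / c)))"

text \<open>Only the behaviour away from the source point \<open>s\<close> is prescribed.\<close>

definition point_source_field :: "real \<Rightarrow> plane \<Rightarrow> (plane \<Rightarrow> real \<Rightarrow> real) \<Rightarrow> bool" where
  "point_source_field c s w \<longleftrightarrow>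
     smooth_on ((- {s}) \<times> {0<..}) (\<lambda>p. w (fst p) (snd p)) \<and> wave_equation (- {s}) {0<..} c w"

definition incident_data where
  "incident_data N \<Gamma> c \<rho> f g \<longleftrightarrow>
     (\<exists>w. plane_wave (c 1) w \<and>
        (\<forall>j\<in>{1..N-1}. \<forall>x\<in>\<Gamma> j. \<forall>t>0.
           f j x t = of_bool (j = 1) * w x t \<and>
           g j x t = of_bool (j = 1) / \<rho> 1 * normal_deriv (\<Gamma> j) w x t)) \<or>
     (\<exists>w. \<exists>j0\<in>{1..N}. \<exists>s\<in>layer N \<Gamma> j0. point_source_field (c j0) s w \<and>
        (\<forall>j\<in>{1..N-1}. \<forall>x\<in>\<Gamma> j. \<forall>t>0.
           f j x t = (of_bool (j = j0) - of_bool (j + 1 = j0)) * w x t \<and>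
           g j x t = (of_bool (j = j0) / \<rho> j - of_bool (j + 1 = j0) / \<rho> (j+1)) *
                     normal_deriv (\<Gamma> j) w x t))"


section \<open>Additive multiple scattering\<close>

text \<open>\<open>up j m\<close> and \<open>um j m\<close> are the \<open>m\<close>-th iterates in medium \<open>j\<close> above \<open>\<Gamma> j\<close> and below
  \<open>\<Gamma> (j-1)\<close>; thus \<open>up j m\<close> is paired with \<open>um (j+1) m\<close>, and \<open>um 1 m\<close>, \<open>up N m\<close> are never used.\<close>

definition iterate_f where
  "iterate_f N f up um j m x t =
     (if m = 1 then f j x t
      else (if j = 1 then 0 else um j (m-1) x t) -
           (if j + 1 = N then 0 else up (j+1) (m-1) x t))"

definition iterate_g where
  "iterate_g N \<Gamma> \<rho> g up um j m x t =
     (if m = 1 then g j x t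
      else (if j = 1 then 0 else normal_deriv (\<Gamma> j) (um j (m-1)) x t / \<rho> j) -
           (if j + 1 = N then 0 else normal_deriv (\<Gamma> j) (up (j+1) (m-1)) x t / \<rho> (j+1)))"

definition multiple_scattering where
  "multiple_scattering X N \<Gamma> c \<rho> f g up um \<longleftrightarrow>
     (\<forall>m\<ge>1. \<forall>j\<in>{1..N-1}.
        two_layered_problem X \<Gamma> c \<rho> j {0<..}
          (iterate_f N f up um j m) (iterate_g N \<Gamma> \<rho> g up um j m) (up j m) (um (j+1) m))"

definition scattering_sum ::
  "nat \<Rightarrow> (nat \<Rightarrow> nat \<Rightarrow> plane \<Rightarrow> real \<Rightarrow> real) \<Rightarrow> (nat \<Rightarrow> nat \<Rightarrow> plane \<Rightarrow> real \<Rightarrow> real) \<Rightarrow>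
   nat \<Rightarrow> nat \<Rightarrow> plane \<Rightarrow> real \<Rightarrow> real" where
  "scattering_sum N up um M j x t =
     (\<Sum>m=1..M. (if j = 1 then 0 else um j m x t) + (if j = N then 0 else up j m x t))"

definition validity_time ::
  "nat \<Rightarrow> (nat \<Rightarrow> plane set) \<Rightarrow> (nat \<Rightarrow> real) \<Rightarrow> real \<Rightarrow> nat \<Rightarrow> real" where
  "validity_time N \<Gamma> c t\<^sub>0 M =
     t\<^sub>0 + real M * Min ((\<lambda>j. setdist (\<Gamma> j) (\<Gamma> (j+1)) / c (j+1)) ` {1..N-2})"

end

theory Submission
  imports Defs
begin

text \<open>
The sum of all scattering orders up to \<open>M\<close> is a solution of the \<open>N\<close>-layered problem with slightly wrong
data, and the error in the data starts too late to be noticed before the time \<open>T(M)\<close>.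

Add, in each layer, the two waves of order \<open>m\<close> that live there: the one below the upper boundary and
the one above the lower boundary of the layer. Across \<open>\<Gamma> j\<close>, the pair that belongs to \<open>\<Gamma> j\<close> jumps by
the data of order \<open>m\<close>. The waves of the two neighbouring interfaces are smooth near \<open>\<Gamma> j\<close>, each on
its own side, and the data of order \<open>m + 1\<close> are defined to be minus the jump that they make. So the
field of order \<open>m\<close> solves the layered problem with the difference of the data of orders \<open>m\<close> and \<open>m + 1\<close>
(\<open>order_field_layered_problem\<close>). The sum over \<open>m\<close> telescopes: the data of the sum up to order \<open>M\<close>
are the given ones minus those of order \<open>M + 1\<close> (\<open>scattering_sum_layered_problem\<close>).

It remains to see that the data of order \<open>m\<close> vanish up to time \<open>t\<^sub>0 + (m - 1) \<delta>\<close>, where \<open>\<delta>\<close> is the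
shortest time in which a wave crosses an inner layer (\<open>iterate_data_vanish\<close>). As long as its data
vanish, a two-layered solution vanishes, because the problem on an initial time interval has only one
solution. Afterwards the wave travels with speed at most \<open>c\<close>, so that it reaches the next interface
not before another \<open>\<delta>\<close>; until then it is zero near that interface together with its gradient. On
\<open>(0, T(M))\<close>, the sum and \<open>u\<close> therefore solve the same problem, hence are equal; both vanish at time 0, and
both are continuous at time \<open>T(M)\<close>.

Finite speed of propagation (\<open>finite_propagation_speed\<close>) is purely local: the energy identity is
needed only inside a backward light cone that stays away from the interface. The energy current is
multiplied by a weight which is supported in the cone and decreases along it, and integrated over a box
in space and time. The fluxes through all faces are zero, so the integral of the divergence is zero;
on the other hand the divergence is nowhere positive, and it is strictly negative where the weight and
the energy density on the axis of the cone are positive. Hence the energy density vanishes there.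

The geometry enters only through the fact that each interface lies entirely above the next one.
Since the interfaces are connected and flat near infinity, this needs no separation theorem: one
follows an interface to its flat part and moves away from there (\<open>interface_connected_to_axis\<close>).
\<close>

section \<open>Functions of class C^2 in space and time\<close>

abbreviation dir_deriv :: "('a::euclidean_space \<Rightarrow> real) \<Rightarrow> 'a \<Rightarrow> 'a \<Rightarrow> real" where
  "dir_deriv f v \<equiv> (\<lambda>p. frechet_derivative f (at p) v)"

lemma Ck_on_subset: "Ck_on k S f \<Longrightarrow> T \<subseteq> S \<Longrightarrow> Ck_on k T f"
  by (induction k arbitrary: f) (auto intro: continuous_on_subset differentiable_on_subset)

lemma Ck_on_zero: "Ck_on k S (\<lambda>x. 0)"
  by (induction k) (auto simp: frechet_derivative_const)

lemma Ck_on_cong: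
  assumes "open S" "Ck_on k S f" "\<And>x. x \<in> S \<Longrightarrow> f x = g x"
  shows "Ck_on k S g"
  using assms(2,3)
proof (induction k arbitrary: f g)
  case 0
  then show ?case by (simp cong: continuous_on_cong)
next
  case (Suc k)
  have df: "f differentiable at x" if "x \<in> S" for x
    using Suc.prems(1) that \<open>open S\<close> by (simp add: differentiable_on_eq_differentiable_at)
  have eq: "frechet_derivative f (at x) = frechet_derivative g (at x)" if "x \<in> S" for x
    using frechet_derivative_transform_within_open[OF df[OF that] \<open>open S\<close> that] Suc.prems(2) by blast
  have "g differentiable_on S"
    using df Suc.prems(2) \<open>open S\<close>
    by (metis (no_types, opaque_lifting) differentiable_def differentiable_on_eq_differentiable_at
        has_derivative_transform_within_open)
  moreover have "Ck_on k S (dir_deriv g v)" for v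
    using Suc.IH[of "dir_deriv f v" "dir_deriv g v"] Suc.prems(1) eq by simp
  ultimately show ?case by simp
qed

lemma dir_deriv_add:
  assumes "f differentiable (at x)" "g differentiable (at x)"
  shows "frechet_derivative (\<lambda>x. f x + g x) (at x) v
    = frechet_derivative f (at x) v + frechet_derivative g (at x) v"
  using assms
  by (intro frechet_derivative_at[symmetric, THEN fun_cong] has_derivative_add)
    (simp_all add: frechet_derivative_works[symmetric])

lemma Ck_on_add:
  assumes "open S" "Ck_on k S f" "Ck_on k S g"
  shows "Ck_on k S (\<lambda>x. f x + g x)"
  using assms(2,3)
proof (induction k arbitrary: f g)
  case 0
  then show ?case by (simp add: continuous_on_add)
next
  case (Suc k)
  have df: "f differentiable at x" "g differentiable at x" if "x \<in> S" for x
    using Suc.prems that \<open>open S\<close> by (simp_all add: differentiable_on_eq_differentiable_at)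
  have eq: "dir_deriv f v x + dir_deriv g v x = dir_deriv (\<lambda>x. f x + g x) v x" if "x \<in> S" for x v
    using dir_deriv_add[OF df[OF that]] by simp
  have "Ck_on k S (\<lambda>x. dir_deriv f v x + dir_deriv g v x)" for v
    using Suc by simp
  then have "Ck_on k S (dir_deriv (\<lambda>x. f x + g x) v)" for v
    by (rule Ck_on_cong[OF \<open>open S\<close> _ eq])
  then show ?case using Suc.prems by (simp add: differentiable_on_add)
qed

lemma
  assumes "open S" "Ck_on 2 S f"
  shows C2_has_derivative: "p \<in> S \<Longrightarrow> (f has_derivative frechet_derivative f (at p)) (at p)"
    and C2_has_derivative2:
      "p \<in> S \<Longrightarrow> (dir_deriv f v has_derivative frechet_derivative (dir_deriv f v) (at p)) (at p)"
    and C2_continuous: "continuous_on S f"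
    and C2_continuous1: "continuous_on S (dir_deriv f v)"
    and C2_continuous2: "continuous_on S (dir_deriv (dir_deriv f v) w)"
  using assms
  by (auto simp: numeral_2_eq_2 frechet_derivative_works[symmetric] differentiable_on_eq_differentiable_at
      intro!: differentiable_imp_continuous_on)

lemma has_derivative_along_line:
  fixes f :: "'a::real_normed_vector \<Rightarrow> real"
  assumes "(f has_derivative f') (at (a + s *\<^sub>R v))"
  shows "((\<lambda>s. f (a + s *\<^sub>R v)) has_real_derivative f' v) (at s)"
proof -
  have lin: "linear f'" using assms by (simp add: has_derivative_def bounded_linear.linear)
  have "((\<lambda>s. a + s *\<^sub>R v) has_derivative (\<lambda>h. h *\<^sub>R v)) (at s)"
    by (auto intro!: derivative_eq_intros)
  from has_derivative_compose[OF this assms] show ?thesis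
    by (simp add: has_field_derivative_def linear_scale[OF lin] mult_commute_abs)
qed

text \<open>The mean value theorem, applied first to the difference along \<open>w\<close> as a function of the step
  along \<open>v\<close>, and then to the derivative along \<open>v\<close>. The left-hand side is symmetric in \<open>v\<close> and \<open>w\<close>, which
  gives Schwarz's theorem.\<close>

lemma second_difference:
  fixes f :: "'a::euclidean_space \<Rightarrow> real"
  assumes S: "open S" "Ck_on 2 S f" and h: "0 < h"
    and sub: "\<And>s t. 0 \<le> s \<Longrightarrow> s \<le> h \<Longrightarrow> 0 \<le> t \<Longrightarrow> t \<le> h \<Longrightarrow> p + s *\<^sub>R v + t *\<^sub>R w \<in> S"
  shows "\<exists>s t. 0 < s \<and> s < h \<and> 0 < t \<and> t < h \<and>
    f (p + h *\<^sub>R v + h *\<^sub>R w) - f (p + h *\<^sub>R v) - f (p + h *\<^sub>R w) + f p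
      = h * h * dir_deriv (dir_deriv f v) w (p + s *\<^sub>R v + t *\<^sub>R w)"
proof -
  define g where "g = (\<lambda>s. f (p + s *\<^sub>R v + h *\<^sub>R w) - f (p + s *\<^sub>R v))"
  have dg: "(g has_real_derivative
      dir_deriv f v (p + s *\<^sub>R v + h *\<^sub>R w) - dir_deriv f v (p + s *\<^sub>R v)) (at s)"
    if "0 \<le> s" "s \<le> h" for s
  proof -
    have in1: "p + s *\<^sub>R v + h *\<^sub>R w \<in> S" using sub[of s h] that h by simp
    have in2: "p + s *\<^sub>R v \<in> S" using sub[of s 0] that h by simp
    have in1': "p + h *\<^sub>R w + s *\<^sub>R v \<in> S" using in1 by (simp add: ac_simps)
    have "((\<lambda>s. f (p + h *\<^sub>R w + s *\<^sub>R v) - f (p + s *\<^sub>R v)) has_real_derivative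
        dir_deriv f v (p + h *\<^sub>R w + s *\<^sub>R v) - dir_deriv f v (p + s *\<^sub>R v)) (at s)"
      by (rule DERIV_diff[OF has_derivative_along_line[OF C2_has_derivative[OF S in1']]
            has_derivative_along_line[OF C2_has_derivative[OF S in2]]])
    moreover have "p + h *\<^sub>R w + r *\<^sub>R v = p + r *\<^sub>R v + h *\<^sub>R w" for r
      by (simp only: ac_simps)
    ultimately show ?thesis
      unfolding g_def by simp
  qed
  obtain s where s: "0 < s" "s < h" and
    es: "g h - g 0 = (h - 0) * (dir_deriv f v (p + s *\<^sub>R v + h *\<^sub>R w) - dir_deriv f v (p + s *\<^sub>R v))"
    using MVT2[OF h dg] by auto
  define k where "k = (\<lambda>t. dir_deriv f v (p + s *\<^sub>R v + t *\<^sub>R w))"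
  have dk: "(k has_real_derivative dir_deriv (dir_deriv f v) w (p + s *\<^sub>R v + t *\<^sub>R w)) (at t)"
    if "0 \<le> t" "t \<le> h" for t
  proof -
    have in1: "p + s *\<^sub>R v + t *\<^sub>R w \<in> S" using sub[of s t] that s by simp
    show ?thesis
      unfolding k_def by (rule has_derivative_along_line[OF C2_has_derivative2[OF S in1]])
  qed
  obtain t where t: "0 < t" "t < h" and
    et: "k h - k 0 = (h - 0) * dir_deriv (dir_deriv f v) w (p + s *\<^sub>R v + t *\<^sub>R w)"
    using MVT2[OF h dk] by auto
  have "g h - g 0 = h * (k h - k 0)"
    using es by (simp add: k_def)
  then show ?thesis
    using s t et by (intro exI[of _ s] exI[of _ t]) (simp add: g_def algebra_simps)
qed

text \<open>Schwarz's theorem: both mixed derivatives at \<open>p\<close> are limits of the same second differences.\<close>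

lemma mixed_derivatives_commute:
  fixes f :: "'a::euclidean_space \<Rightarrow> real"
  assumes S: "open S" "Ck_on 2 S f" and p: "p \<in> S"
  shows "dir_deriv (dir_deriv f v) w p = dir_deriv (dir_deriv f w) v p"
proof (rule dense_eq0_I[of "_ - _", simplified])
  fix e :: real assume e: "0 < e"
  let ?A = "dir_deriv (dir_deriv f v) w" and ?B = "dir_deriv (dir_deriv f w) v"
  have "continuous (at p) ?A" "continuous (at p) ?B"
    using C2_continuous2[OF S] p S(1) by (auto simp: continuous_on_eq_continuous_at)
  then obtain d1 d2 where d: "d1 > 0" "d2 > 0"
    and A: "\<And>q. dist q p < d1 \<Longrightarrow> dist (?A q) (?A p) < e/2"
    and B: "\<And>q. dist q p < d2 \<Longrightarrow> dist (?B q) (?B p) < e/2"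
    using e unfolding continuous_at_eps_delta by (metis half_gt_zero)
  obtain d3 where d3: "d3 > 0" "ball p d3 \<subseteq> S"
    using S(1) p openE by blast
  define d where "d = min d3 (min d1 d2)"
  \<comment> \<open>The step is so small that the whole parallelogram lies within distance \<open>d\<close> of \<open>p\<close>.\<close>
  define h where "h = d / 2 / (norm v + norm w + 1)"
  have dpos: "d > 0" using d d3 by (simp add: d_def)
  have hpos: "h > 0" unfolding h_def using dpos by (intro divide_pos_pos) (auto simp: add_nonneg_pos)
  have hd: "h * (norm v + norm w) < d"
  proof -
    have "h * (norm v + norm w) \<le> h * (norm v + norm w + 1)"
      using hpos by (simp add: mult_left_mono)
    also have "\<dots> = d / 2"
    proof -
      have "norm v + norm w + 1 \<noteq> 0"
        using norm_ge_zero[of v] norm_ge_zero[of w] by linarith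
      then show ?thesis by (simp add: h_def divide_simps)
    qed
    finally show ?thesis using dpos by simp
  qed
  have near: "dist (p + s *\<^sub>R v + t *\<^sub>R w) p < d" if "0 \<le> s" "s \<le> h" "0 \<le> t" "t \<le> h" for s t
  proof -
    have "dist (p + s *\<^sub>R v + t *\<^sub>R w) p \<le> s * norm v + t * norm w"
      using that norm_triangle_ineq[of "s *\<^sub>R v" "t *\<^sub>R w"] by (simp add: dist_norm)
    also have "\<dots> \<le> h * (norm v + norm w)"
      using that by (simp add: distrib_left add_mono mult_right_mono)
    finally show ?thesis using hd by simp
  qed
  have sub: "p + s *\<^sub>R v + t *\<^sub>R w \<in> S" "p + s *\<^sub>R w + t *\<^sub>R v \<in> S"
    if "0 \<le> s" "s \<le> h" "0 \<le> t" "t \<le> h" for s t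
    using near[OF that] near[OF that(3,4,1,2)] d3(2)
    by (auto simp: d_def dist_commute add.commute add.left_commute subset_iff)
  obtain s t where st: "0 < s" "s < h" "0 < t" "t < h"
    and e1: "f (p + h *\<^sub>R v + h *\<^sub>R w) - f (p + h *\<^sub>R v) - f (p + h *\<^sub>R w) + f p
      = h * h * ?A (p + s *\<^sub>R v + t *\<^sub>R w)"
    using second_difference[OF S hpos sub(1)] by blast
  obtain s' t' where st': "0 < s'" "s' < h" "0 < t'" "t' < h"
    and e2: "f (p + h *\<^sub>R w + h *\<^sub>R v) - f (p + h *\<^sub>R w) - f (p + h *\<^sub>R v) + f p
      = h * h * ?B (p + s' *\<^sub>R w + t' *\<^sub>R v)"
    using second_difference[OF S hpos sub(2)] by blast
  have swap: "p + h *\<^sub>R w + h *\<^sub>R v = p + h *\<^sub>R v + h *\<^sub>R w"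
    "p + s' *\<^sub>R w + t' *\<^sub>R v = p + t' *\<^sub>R v + s' *\<^sub>R w"
    by (simp_all add: algebra_simps)
  have "h * h * ?A (p + s *\<^sub>R v + t *\<^sub>R w) = h * h * ?B (p + t' *\<^sub>R v + s' *\<^sub>R w)"
    using e1 e2 unfolding swap by linarith
  then have "?A (p + s *\<^sub>R v + t *\<^sub>R w) = ?B (p + t' *\<^sub>R v + s' *\<^sub>R w)"
    using hpos by simp
  moreover have "dist (?A (p + s *\<^sub>R v + t *\<^sub>R w)) (?A p) < e/2"
    using A near[of s t] st by (simp add: d_def)
  moreover have "dist (?B (p + t' *\<^sub>R v + s' *\<^sub>R w)) (?B p) < e/2"
    using B near[of t' s'] st' by (simp add: d_def)
  ultimately show "\<bar>?A p - ?B p\<bar> \<le> e"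
    unfolding dist_real_def by linarith
qed

abbreviation spacetime :: "(plane \<Rightarrow> real \<Rightarrow> real) \<Rightarrow> plane \<times> real \<Rightarrow> real" where
  "spacetime u \<equiv> (\<lambda>p. u (fst p) (snd p))"

text \<open>The wave equation and the solution class speak of derivatives in time at a fixed place and in space
  at a fixed time. They are rewritten as directional derivatives in space-time, where the energy
  identity takes place and derivatives are known to be continuous.\<close>

context
  fixes D :: "plane set" and J :: "real set" and u :: "plane \<Rightarrow> real \<Rightarrow> real"
  assumes oD: "open D" and oJ: "open J" and C2: "Ck_on 2 (D \<times> J) (spacetime u)"
begin

private lemma oS: "open (D \<times> J)" using oD oJ by (rule open_Times)

lemma time_slice_derivative:
  assumes "x \<in> D" "t \<in> J"
  shows "(u x has_real_derivative dir_deriv (spacetime u) (0, 1) (x, t)) (at t)"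
  using has_derivative_along_line[of "spacetime u" _ "(x, 0)" t "(0, 1)"]
    C2_has_derivative[OF oS C2, of "(x, t)"] assms by simp

lemma time_slice_second_derivative:
  assumes "x \<in> D" "t \<in> J"
  shows "deriv (deriv (u x)) t = dir_deriv (dir_deriv (spacetime u) (0, 1)) (0, 1) (x, t)"
proof -
  let ?V = "dir_deriv (spacetime u) (0, 1)"
  have "((\<lambda>s. ?V (x, s)) has_real_derivative dir_deriv ?V (0, 1) (x, t)) (at t)"
    using has_derivative_along_line[of ?V _ "(x, 0)" t "(0, 1)"]
      C2_has_derivative2[OF oS C2, of "(x, t)"] assms by simp
  then have "(deriv (u x) has_real_derivative dir_deriv ?V (0, 1) (x, t)) (at t)"
    by (rule has_field_derivative_transform_within_open[OF _ oJ assms(2)])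
      (rule DERIV_imp_deriv[OF time_slice_derivative[OF assms(1)], symmetric])
  then show ?thesis by (rule DERIV_imp_deriv)
qed

lemma space_slice_derivative:
  assumes "x \<in> D" "t \<in> J"
  shows "((\<lambda>y. u y t) has_derivative (\<lambda>h. frechet_derivative (spacetime u) (at (x, t)) (h, 0))) (at x)"
proof -
  have d: "(spacetime u has_derivative frechet_derivative (spacetime u) (at (x, t))) (at (x, t))"
    using C2_has_derivative[OF oS C2, of "(x, t)"] assms by simp
  have "((\<lambda>y. spacetime u (y, t)) has_derivative
      (\<lambda>h. frechet_derivative (spacetime u) (at (x, t)) (h, 0))) (at x)"
    by (rule has_derivative_compose[where f="\<lambda>y. (y, t)" and g="spacetime u", OF _ d])
      (intro has_derivative_Pair has_derivative_const has_derivative_ident)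
  then show ?thesis by simp
qed

lemma space_slice_differentiable:
  "x \<in> D \<Longrightarrow> t \<in> J \<Longrightarrow> (\<lambda>y. u y t) differentiable (at x)"
  by (rule differentiableI[OF space_slice_derivative])

lemma frechet_derivative_space_slice:
  assumes "x \<in> D" "t \<in> J"
  shows "frechet_derivative (\<lambda>y. u y t) (at x) v = dir_deriv (spacetime u) (v, 0) (x, t)"
  by (rule frechet_derivative_at[OF space_slice_derivative[OF assms], symmetric, THEN fun_cong])

lemma laplacian_space_slice:
  assumes "x \<in> D" "t \<in> J"
  shows "laplacian (\<lambda>y. u y t) x =
    (\<Sum>i\<in>Basis. dir_deriv (dir_deriv (spacetime u) (i, 0)) (i, 0) (x, t))"
  unfolding laplacian_def
proof (rule sum.cong[OF refl])
  fix i :: plane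
  let ?V = "dir_deriv (spacetime u) (i, 0)"
  have d: "(?V has_derivative frechet_derivative ?V (at (x, t))) (at (x, t))"
    using C2_has_derivative2[OF oS C2, of "(x, t)"] assms by simp
  have "((\<lambda>y. ?V (y, t)) has_derivative (\<lambda>h. frechet_derivative ?V (at (x, t)) (h, 0))) (at x)"
    by (rule has_derivative_compose[where f="\<lambda>y. (y, t)" and g="?V", OF _ d])
      (intro has_derivative_Pair has_derivative_const has_derivative_ident)
  then have "((\<lambda>y. frechet_derivative (\<lambda>y. u y t) (at y) i) has_derivative
      (\<lambda>h. frechet_derivative ?V (at (x, t)) (h, 0))) (at x)"
    by (rule has_derivative_transform_within_open[OF _ oD assms(1)])
      (simp add: frechet_derivative_space_slice assms(2))
  then show "frechet_derivative (\<lambda>y. frechet_derivative (\<lambda>y. u y t) (at y) i) (at x) i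
      = dir_deriv ?V (i, 0) (x, t)"
    by (rule frechet_derivative_at[symmetric, THEN fun_cong])
qed

lemma wave_equation_spacetime:
  "wave_equation D J c u \<longleftrightarrow> (\<forall>x\<in>D. \<forall>t\<in>J.
     dir_deriv (dir_deriv (spacetime u) (0, 1)) (0, 1) (x, t) =
     c\<^sup>2 * (\<Sum>i\<in>Basis. dir_deriv (dir_deriv (spacetime u) (i, 0)) (i, 0) (x, t)))"
  by (simp add: wave_equation_def time_slice_second_derivative laplacian_space_slice)

lemma continuous_on_space_slice: "t \<in> J \<Longrightarrow> continuous_on D (\<lambda>y. u y t)"
  by (rule continuous_on_compose2[OF C2_continuous[OF oS C2], of _ "\<lambda>y. (y, t)", simplified])
    (auto intro!: continuous_intros)

lemma continuous_on_space_slice_derivative: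
  assumes "t \<in> J"
  shows "continuous_on D (\<lambda>y. frechet_derivative (\<lambda>z. u z t) (at y) v)"
proof -
  have "continuous_on D (\<lambda>y. dir_deriv (spacetime u) (v, 0) (y, t))"
    by (rule continuous_on_compose2[OF C2_continuous1[OF oS C2], of _ "\<lambda>y. (y, t)", simplified])
      (auto intro!: continuous_intros assms)
  then show ?thesis
    by (rule continuous_on_eq) (simp add: frechet_derivative_space_slice assms)
qed

end

lemma wave_equation_add:
  assumes "open D" "open J"
    and u: "Ck_on 2 (D \<times> J) (spacetime u)" "wave_equation D J c u"
    and v: "Ck_on 2 (D \<times> J) (spacetime v)" "wave_equation D J c v"
  shows "wave_equation D J c (\<lambda>x t. u x t + v x t)"
proof -
  have S: "open (D \<times> J)" using assms(1,2) by (rule open_Times)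
  have d1: "dir_deriv (\<lambda>p. spacetime u p + spacetime v p) w p
      = dir_deriv (spacetime u) w p + dir_deriv (spacetime v) w p" if "p \<in> D \<times> J" for w p
    by (rule dir_deriv_add[OF differentiableI[OF C2_has_derivative[OF S u(1) that]]
          differentiableI[OF C2_has_derivative[OF S v(1) that]]])
  have d2: "dir_deriv (dir_deriv (\<lambda>p. spacetime u p + spacetime v p) w) w p
      = dir_deriv (dir_deriv (spacetime u) w) w p + dir_deriv (dir_deriv (spacetime v) w) w p"
    if p: "p \<in> D \<times> J" for w p
  proof -
    have "((\<lambda>p. dir_deriv (spacetime u) w p + dir_deriv (spacetime v) w p) has_derivative
        (\<lambda>h. frechet_derivative (dir_deriv (spacetime u) w) (at p) h
           + frechet_derivative (dir_deriv (spacetime v) w) (at p) h)) (at p)"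
      by (intro has_derivative_add C2_has_derivative2[OF S u(1) p] C2_has_derivative2[OF S v(1) p])
    then have "(dir_deriv (\<lambda>p. spacetime u p + spacetime v p) w has_derivative
        (\<lambda>h. frechet_derivative (dir_deriv (spacetime u) w) (at p) h
           + frechet_derivative (dir_deriv (spacetime v) w) (at p) h)) (at p)"
      by (rule has_derivative_transform_within_open[OF _ S p]) (simp only: d1)
    then show ?thesis by (rule frechet_derivative_at[symmetric, THEN fun_cong])
  qed
  show ?thesis
    using u(2) v(2) Ck_on_add[OF S u(1) v(1)]
    by (simp add: wave_equation_spacetime[OF assms(1,2)] u(1) v(1) d2 sum.distrib distrib_left)
qed

section \<open>Energy in a light cone\<close>

lemma integral_time_derivative_eq_0:
  fixes F G :: "'a::euclidean_space \<times> real \<Rightarrow> real"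
  assumes cont: "continuous_on (cbox (a, \<alpha>) (b, \<beta>)) G" and ab: "\<alpha> \<le> \<beta>"
    and F: "\<And>x t. x \<in> cbox a b \<Longrightarrow> t \<in> {\<alpha>..\<beta>} \<Longrightarrow>
      ((\<lambda>t. F (x, t)) has_real_derivative G (x, t)) (at t)"
    and bd: "\<And>x. x \<in> cbox a b \<Longrightarrow> F (x, \<alpha>) = 0" "\<And>x. x \<in> cbox a b \<Longrightarrow> F (x, \<beta>) = 0"
  shows "integral (cbox (a, \<alpha>) (b, \<beta>)) G = 0"
proof -
  have "integral {\<alpha>..\<beta>} (\<lambda>t. G (x, t)) = 0" if x: "x \<in> cbox a b" for x
  proof -
    have "((\<lambda>t. G (x, t)) has_integral F (x, \<beta>) - F (x, \<alpha>)) {\<alpha>..\<beta>}"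
      by (rule fundamental_theorem_of_calculus[OF ab])
        (metis F[OF x] has_real_derivative_iff_has_vector_derivative has_vector_derivative_at_within)
    then show ?thesis using bd[OF x] by (simp add: integral_unique)
  qed
  then have "integral (cbox a b) (\<lambda>x. integral (cbox \<alpha> \<beta>) (\<lambda>t. G (x, t))) = integral (cbox a b) (\<lambda>x. 0)"
    by (intro integral_cong) simp
  then show ?thesis
    by (simp add: integral_prod_continuous[OF cont])
qed

lemma integral_fst_derivative_eq_0:
  fixes F G :: "real \<times> 'a::euclidean_space \<Rightarrow> real"
  assumes cont: "continuous_on (cbox (\<alpha>, a) (\<beta>, b)) G" and ab: "\<alpha> \<le> \<beta>"
    and F: "\<And>x t. x \<in> cbox a b \<Longrightarrow> t \<in> {\<alpha>..\<beta>} \<Longrightarrow>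
      ((\<lambda>t. F (t, x)) has_real_derivative G (t, x)) (at t)"
    and bd: "\<And>x. x \<in> cbox a b \<Longrightarrow> F (\<alpha>, x) = 0" "\<And>x. x \<in> cbox a b \<Longrightarrow> F (\<beta>, x) = 0"
  shows "integral (cbox (\<alpha>, a) (\<beta>, b)) G = 0"
proof -
  have "integral (cbox (\<alpha>, a) (\<beta>, b)) (\<lambda>(t, x). G (t, x))
      = integral (cbox (a, \<alpha>) (b, \<beta>)) (\<lambda>(x, t). G (t, x))"
    by (rule integral_swap_2dim) (simp add: cont)
  also have "\<dots> = 0"
  proof (rule integral_time_derivative_eq_0[where F="\<lambda>(x, t). F (t, x)", OF _ ab])
    show "continuous_on (cbox (a, \<alpha>) (b, \<beta>)) (\<lambda>(x, t). G (t, x))"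
      unfolding case_prod_beta
      by (rule continuous_on_compose2[OF cont])
        (auto intro!: continuous_intros simp: cbox_Pair_eq)
  qed (use F bd in auto)
  finally show ?thesis by simp
qed

text \<open>Fubini reduces an integral over space and time to the spatial integrals at fixed times.\<close>

lemma integral_eq_0_if_slices:
  fixes G :: "'a::euclidean_space \<times> real \<Rightarrow> real"
  assumes cont: "continuous_on (cbox (a, \<alpha>) (b, \<beta>)) G"
    and z: "\<And>t. t \<in> {\<alpha>..\<beta>} \<Longrightarrow> integral (cbox a b) (\<lambda>x. G (x, t)) = 0"
  shows "integral (cbox (a, \<alpha>) (b, \<beta>)) G = 0"
proof -
  have "integral (cbox (a, \<alpha>) (b, \<beta>)) G
      = integral (cbox a b) (\<lambda>x. integral (cbox \<alpha> \<beta>) (\<lambda>t. G (x, t)))"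
    by (rule integral_prod_continuous[OF cont])
  also have "\<dots> = integral (cbox \<alpha> \<beta>) (\<lambda>t. integral (cbox a b) (\<lambda>x. G (x, t)))"
    by (rule integral_swap_continuous) (use cont in simp)
  also have "\<dots> = integral (cbox \<alpha> \<beta>) (\<lambda>t. 0)"
    by (rule integral_cong) (use z in simp)
  finally show ?thesis by simp
qed

text \<open>The divergence theorem on a box, for a vector field whose normal component vanishes on each
  face: every partial derivative integrates to zero by itself.\<close>

lemma divergence_theorem_zero_flux:
  fixes Hx Hy Ht Gx Gy Gt :: "plane \<times> real \<Rightarrow> real" and a1 a2 b1 b2 \<alpha> \<beta> :: real
  defines "B \<equiv> cbox ((a1, a2), \<alpha>) ((b1, b2), \<beta>)"
  assumes le: "a1 \<le> b1" "a2 \<le> b2" "\<alpha> \<le> \<beta>"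
    and cont: "continuous_on B Gx" "continuous_on B Gy" "continuous_on B Gt"
    and dx: "\<And>x y t. ((x, y), t) \<in> B \<Longrightarrow>
      ((\<lambda>x. Hx ((x, y), t)) has_real_derivative Gx ((x, y), t)) (at x)"
    and dy: "\<And>x y t. ((x, y), t) \<in> B \<Longrightarrow>
      ((\<lambda>y. Hy ((x, y), t)) has_real_derivative Gy ((x, y), t)) (at y)"
    and dt: "\<And>x y t. ((x, y), t) \<in> B \<Longrightarrow>
      ((\<lambda>t. Ht ((x, y), t)) has_real_derivative Gt ((x, y), t)) (at t)"
    and zx: "\<And>x y t. ((x, y), t) \<in> B \<Longrightarrow> x = a1 \<or> x = b1 \<Longrightarrow> Hx ((x, y), t) = 0"
    and zy: "\<And>x y t. ((x, y), t) \<in> B \<Longrightarrow> y = a2 \<or> y = b2 \<Longrightarrow> Hy ((x, y), t) = 0"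
    and zt: "\<And>x y t. ((x, y), t) \<in> B \<Longrightarrow> t = \<alpha> \<or> t = \<beta> \<Longrightarrow> Ht ((x, y), t) = 0"
  shows "integral B (\<lambda>p. Gx p + Gy p + Gt p) = 0"
proof -
  have slice: "continuous_on (cbox (a1, a2) (b1, b2)) (\<lambda>z. G (z, t))"
    if "continuous_on B G" "t \<in> {\<alpha>..\<beta>}" for G :: "plane \<times> real \<Rightarrow> real" and t
    by (rule continuous_on_compose2[OF that(1)])
      (use that(2) in \<open>auto intro!: continuous_intros simp: B_def cbox_Pair_eq\<close>)
  have "integral B Gx = 0"
    unfolding B_def
  proof (rule integral_eq_0_if_slices)
    show "integral (cbox (a1, a2) (b1, b2)) (\<lambda>z. Gx (z, t)) = 0" if "t \<in> {\<alpha>..\<beta>}" for t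
      by (rule integral_fst_derivative_eq_0[where F="\<lambda>z. Hx (z, t)", OF slice[OF cont(1) that] le(1)])
        (use that le in \<open>auto intro!: dx zx simp: B_def cbox_Pair_eq\<close>)
  qed (use cont B_def in simp)
  moreover have "integral B Gy = 0"
    unfolding B_def
  proof (rule integral_eq_0_if_slices)
    show "integral (cbox (a1, a2) (b1, b2)) (\<lambda>z. Gy (z, t)) = 0" if "t \<in> {\<alpha>..\<beta>}" for t
      by (rule integral_time_derivative_eq_0[where F="\<lambda>z. Hy (z, t)", OF slice[OF cont(2) that] le(2)])
        (use that le in \<open>auto intro!: dy zy simp: B_def cbox_Pair_eq\<close>)
  qed (use cont B_def in simp)
  moreover have "integral B Gt = 0"
    unfolding B_def
    by (rule integral_time_derivative_eq_0[where F=Ht])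
      (use cont le in \<open>auto intro!: dt zt simp: B_def cbox_Pair_eq\<close>)
  moreover have "Gx integrable_on B" "Gy integrable_on B" "Gt integrable_on B"
    using cont by (auto simp: B_def intro!: integrable_continuous)
  ultimately show ?thesis
    by (simp add: integral_add integrable_add)
qed

text \<open>At times before \<open>T\<close>, this is positive exactly inside the backward light cone with apex \<open>(x0, T)\<close>. The primed
  constants are the derivatives of the unprimed ones, as functions of the direction \<open>h\<close>.\<close>

definition cone_fun :: "real \<Rightarrow> plane \<Rightarrow> real \<Rightarrow> plane \<times> real \<Rightarrow> real" where
  "cone_fun c x0 T p = c\<^sup>2 * (T - snd p)\<^sup>2 - (norm (fst p - x0))\<^sup>2"

definition cone_fun' :: "real \<Rightarrow> plane \<Rightarrow> real \<Rightarrow> plane \<times> real \<Rightarrow> plane \<times> real \<Rightarrow> real" where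
  "cone_fun' c x0 T p h = - 2 * c\<^sup>2 * (T - snd p) * snd h - 2 * ((fst p - x0) \<bullet> fst h)"

text \<open>The square of the positive part: before time \<open>T\<close> it is zero outside of the cone, and, other than the
  positive part itself, it is differentiable across the surface of the cone.\<close>

definition cone_weight :: "real \<Rightarrow> plane \<Rightarrow> real \<Rightarrow> plane \<times> real \<Rightarrow> real" where
  "cone_weight c x0 T p = (max 0 (cone_fun c x0 T p))\<^sup>2"

definition cone_weight' :: "real \<Rightarrow> plane \<Rightarrow> real \<Rightarrow> plane \<times> real \<Rightarrow> plane \<times> real \<Rightarrow> real" where
  "cone_weight' c x0 T p h = 2 * max 0 (cone_fun c x0 T p) * cone_fun' c x0 T p h"

lemma has_derivative_cone_fun:
  "(cone_fun c x0 T has_derivative cone_fun' c x0 T p) (at p)"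
  unfolding cone_fun_def[abs_def] cone_fun'_def[abs_def] power2_norm_eq_inner
  by (auto intro!: derivative_eq_intros simp: fun_eq_iff algebra_simps inner_commute)

lemma DERIV_square_pos_part:
  "((\<lambda>s::real. (max 0 s)\<^sup>2) has_real_derivative 2 * max 0 s) (at s)"
proof (cases s "0::real" rule: linorder_cases)
  case less
  have "((\<lambda>s::real. 0) has_real_derivative 2 * max 0 s) (at s)" using less by simp
  then show ?thesis
    by (rule has_field_derivative_transform_within_open[of _ _ _ "{..<0}"]) (use less in auto)
next
  case greater
  have "((\<lambda>s::real. s\<^sup>2) has_real_derivative 2 * max 0 s) (at s)"
    using greater by (auto intro!: derivative_eq_intros)
  then show ?thesis
    by (rule has_field_derivative_transform_within_open[of _ _ _ "{0<..}"]) (use greater in auto)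
next
  case equal
  have "((\<lambda>h::real. ((max 0 h)\<^sup>2 - (max 0 0)\<^sup>2) / h) \<longlongrightarrow> 0) (at 0)"
  proof (rule Lim_null_comparison)
    show "\<forall>\<^sub>F h in at 0. norm (((max 0 h)\<^sup>2 - (max 0 0)\<^sup>2) / h) \<le> \<bar>h\<bar>"
      by (auto simp: eventually_at_filter max_def power2_eq_square)
    show "((\<lambda>h::real. \<bar>h\<bar>) \<longlongrightarrow> 0) (at 0)"
      by (auto intro!: tendsto_eq_intros)
  qed
  then show ?thesis using equal by (simp add: DERIV_def)
qed

lemma has_derivative_cone_weight:
  "(cone_weight c x0 T has_derivative cone_weight' c x0 T p) (at p)"
  using has_derivative_compose[where g="\<lambda>s. (max 0 s)\<^sup>2", OF has_derivative_cone_fun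
      DERIV_square_pos_part[unfolded has_field_derivative_def]]
  by (simp add: cone_weight_def[abs_def] cone_weight'_def[abs_def])

lemma continuous_on_cone_fun: "continuous_on S (cone_fun c x0 T)"
  by (intro continuous_at_imp_continuous_on ballI has_derivative_continuous[OF has_derivative_cone_fun])

lemma continuous_on_cone_weight: "continuous_on S (cone_weight c x0 T)"
  by (intro continuous_at_imp_continuous_on ballI has_derivative_continuous[OF has_derivative_cone_weight])

lemma continuous_on_cone_weight': "continuous_on S (\<lambda>p. cone_weight' c x0 T p v)"
  unfolding cone_weight'_def cone_fun'_def
  by (intro continuous_intros continuous_on_cone_fun)

text \<open>Multiplication by the cone weight extends a function from \<open>S\<close> by zero, without loss of
  differentiability. Thus the box \<open>B\<close> of integration may be larger than the domain \<open>S\<close> of the wave,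
  provided that it leaves \<open>S\<close> outside of the closed cone.\<close>

lemma
  fixes H :: "plane \<times> real \<Rightarrow> real" and c T :: real and x0 :: plane
  defines "W \<equiv> cone_weight c x0 T" and "W' \<equiv> cone_weight' c x0 T"
  assumes S: "open S" and H: "\<And>p. p \<in> S \<Longrightarrow> (H has_derivative H' p) (at p)"
    and out: "\<And>p. p \<in> B \<Longrightarrow> p \<notin> S \<Longrightarrow> cone_fun c x0 T p < 0"
    and cont: "continuous_on S (\<lambda>p. H' p v)"
  shows cone_weight_cutoff_derivative: "p \<in> B \<Longrightarrow>
      ((\<lambda>p. W p * H p) has_derivative (\<lambda>h. W p * H' p h + W' p h * H p)) (at p)"
    and cone_weight_cutoff_continuous:
      "continuous_on B (\<lambda>p. W p * H' p v + W' p v * H p)"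
proof -
  define Z where "Z = {p. cone_fun c x0 T p < 0}"
  have oZ: "open Z"
    unfolding Z_def by (intro open_Collect_less continuous_on_cone_fun continuous_on_const)
  have W0: "W p = 0" "W' p h = 0" if "p \<in> Z" for p h
    using that by (auto simp: Z_def W_def W'_def cone_weight_def cone_weight'_def)
  show "((\<lambda>p. W p * H p) has_derivative (\<lambda>h. W p * H' p h + W' p h * H p)) (at p)" if "p \<in> B" for p
  proof (cases "p \<in> S")
    case True
    show ?thesis
      unfolding W_def W'_def
      by (rule has_derivative_mult[OF has_derivative_cone_weight H[OF True]])
  next
    case False
    then have p: "p \<in> Z" using out[OF that] by (simp add: Z_def)
    have "((\<lambda>p. 0) has_derivative (\<lambda>h. W p * H' p h + W' p h * H p)) (at p)"
      by (simp add: W0[OF p])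
    then show ?thesis
      by (rule has_derivative_transform_within_open[OF _ oZ p]) (simp add: W0)
  qed
  have "continuous_on S H"
    by (intro continuous_at_imp_continuous_on ballI has_derivative_continuous[OF H])
  then have "continuous_on S (\<lambda>p. W p * H' p v + W' p v * H p)"
    unfolding W_def W'_def
    by (intro continuous_intros continuous_on_cone_weight continuous_on_cone_weight' cont)
  moreover have "continuous_on Z (\<lambda>p. W p * H' p v + W' p v * H p)"
    by (rule continuous_on_eq[OF continuous_on_const[of _ 0]]) (simp add: W0)
  ultimately have "continuous_on (S \<union> Z) (\<lambda>p. W p * H' p v + W' p v * H p)"
    by (rule continuous_on_open_Un[OF S oZ])
  then show "continuous_on B (\<lambda>p. W p * H' p v + W' p v * H p)"
    by (rule continuous_on_subset) (use out in \<open>auto simp: Z_def\<close>)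
qed

text \<open>Inside the cone the energy flux through its level surfaces is at most what the shrinking of the
  cone takes away; this is the place where the propagation speed is compared to the slope \<open>c\<close>.\<close>

lemma flux_bound:
  fixes c a u1 u2 y1 y2 d :: real
  assumes "c > 0" "d \<ge> 0" and cone: "y1\<^sup>2 + y2\<^sup>2 \<le> c\<^sup>2 * d\<^sup>2"
  shows "a * (y1 * u1 + y2 * u2) \<le> d * ((a\<^sup>2 + c\<^sup>2 * (u1\<^sup>2 + u2\<^sup>2)) / 2)"
proof -
  define X where "X = sqrt (u1\<^sup>2 + u2\<^sup>2)"
  have X2: "X\<^sup>2 = u1\<^sup>2 + u2\<^sup>2" by (simp add: X_def)
  have "\<bar>y1 * u1 + y2 * u2\<bar> \<le> sqrt (y1\<^sup>2 + y2\<^sup>2) * X"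
    using Cauchy_Schwarz_ineq2[of "(y1, y2)" "(u1, u2)"] by (simp add: norm_Pair X_def)
  also have "\<dots> \<le> c * d * X"
    using assms by (intro mult_right_mono real_le_lsqrt) (auto simp: power_mult_distrib X_def)
  finally have "\<bar>a\<bar> * \<bar>y1 * u1 + y2 * u2\<bar> \<le> \<bar>a\<bar> * (c * d * X)"
    by (intro mult_left_mono) auto
  then have "a * (y1 * u1 + y2 * u2) \<le> d * (\<bar>a\<bar> * (c * X))"
    using abs_ge_self[of "a * (y1 * u1 + y2 * u2)"] by (simp only: abs_mult ac_simps)
  also have "\<bar>a\<bar> * (c * X) \<le> (a\<^sup>2 + c\<^sup>2 * (u1\<^sup>2 + u2\<^sup>2)) / 2"
    using sum_squares_bound[of "\<bar>a\<bar>" "c * X"] by (simp add: power_mult_distrib X2)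
  then have "d * (\<bar>a\<bar> * (c * X)) \<le> d * ((a\<^sup>2 + c\<^sup>2 * (u1\<^sup>2 + u2\<^sup>2)) / 2)"
    using assms(2) by (rule mult_left_mono)
  finally show ?thesis .
qed

text \<open>The energy identity, weighted with the cone weight. At the bottom of the box, \<open>t = \<alpha>\<close>, the wave
  is still zero; at the top, \<open>t = T\<close>, the cone has shrunk to a point; and the sides of the box are outside of
  the cone. So all fluxes vanish, and so does the integral of the divergence. Only the axis of
  the cone is of interest, since every point is the centre of its own cone.\<close>

lemma energy_vanishes_on_axis:
  assumes c: "c > 0" and \<alpha>: "0 < \<alpha>" "\<alpha> < \<tau>" "\<alpha> < T" and r: "c * (T - \<alpha>) < r"
    and C2: "Ck_on 2 (ball x0 r \<times> {0<..}) (spacetime u)"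
    and wave: "wave_equation (ball x0 r) {0<..} c u"
    and zero: "\<And>x t. x \<in> ball x0 r \<Longrightarrow> 0 < t \<Longrightarrow> t < \<tau> \<Longrightarrow> u x t = 0"
    and s: "\<alpha> \<le> s" "s < T"
  shows "dir_deriv (spacetime u) (0, 1) (x0, s) = 0"
proof -
  define S where "S = ball x0 r \<times> {0::real<..}"
  define U where "U = spacetime u"
  define e1 e2 e3 :: "plane \<times> real" where "e1 = ((1, 0), 0)" and "e2 = ((0, 1), 0)" and "e3 = (0, 1)"
  let ?u1 = "dir_deriv U e1" and ?u2 = "dir_deriv U e2" and ?ut = "dir_deriv U e3"
  define B where "B = cbox ((fst x0 - r, snd x0 - r), \<alpha>) ((fst x0 + r, snd x0 + r), T)"
  define q W W' where "q = cone_fun c x0 T" and "W = cone_weight c x0 T" and "W' = cone_weight' c x0 T"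
  have S: "open S" by (simp add: S_def open_Times)
  have C2: "Ck_on 2 S U" using C2 by (simp add: S_def U_def)
  have rpos: "r > 0" using r c \<alpha> by (smt (verit) mult_pos_pos)
  have tpos: "t \<in> {\<alpha>..T}" if "(x, t) \<in> B" for x t
    using that by (auto simp: B_def cbox_Pair_eq)
  have q_neg: "q (x, t) < 0" if "t \<in> {\<alpha>..T}" "r \<le> norm (x - x0)" for x t
  proof -
    have "(c * (T - t))\<^sup>2 < r\<^sup>2"
    proof (rule power_strict_mono)
      have "c * (T - t) \<le> c * (T - \<alpha>)" using c that by (intro mult_left_mono) auto
      then show "c * (T - t) < r" using r by simp
    qed (use c that in auto)
    also have "r\<^sup>2 \<le> (norm (x - x0))\<^sup>2" using that rpos by (intro power_mono) auto
    finally show ?thesis by (simp add: q_def cone_fun_def power_mult_distrib)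
  qed
  have out: "q p < 0" if "p \<in> B" "p \<notin> S" for p
    using that tpos[of "fst p" "snd p"] \<alpha> q_neg[of "snd p" "fst p"]
    by (auto simp: S_def mem_Times_iff dist_norm norm_minus_commute)
  \<comment> \<open>The energy density and the two components of its flux; primed: their derivatives.\<close>
  define Ht where "Ht p = ((?ut p)\<^sup>2 + c\<^sup>2 * ((?u1 p)\<^sup>2 + (?u2 p)\<^sup>2)) / 2" for p
  define H1 where "H1 p = - c\<^sup>2 * (?ut p * ?u1 p)" for p
  define H2 where "H2 p = - c\<^sup>2 * (?ut p * ?u2 p)" for p
  define Ht' where "Ht' p h = ?ut p * dir_deriv ?ut h p
      + c\<^sup>2 * (?u1 p * dir_deriv ?u1 h p + ?u2 p * dir_deriv ?u2 h p)" for p h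
  define H1' where "H1' p h = - c\<^sup>2 * (?ut p * dir_deriv ?u1 h p + dir_deriv ?ut h p * ?u1 p)" for p h
  define H2' where "H2' p h = - c\<^sup>2 * (?ut p * dir_deriv ?u2 h p + dir_deriv ?ut h p * ?u2 p)" for p h
  note D2 = C2_has_derivative2[OF S C2]
  have dHt: "(Ht has_derivative Ht' p) (at p)" if "p \<in> S" for p
    unfolding Ht_def[abs_def] Ht'_def[abs_def]
    by (rule has_derivative_eq_rhs, (rule derivative_intros D2[OF that])+) (auto simp: fun_eq_iff field_simps)
  have dH1: "(H1 has_derivative H1' p) (at p)" if "p \<in> S" for p
    unfolding H1_def[abs_def] H1'_def[abs_def]
    by (intro has_derivative_mult_right has_derivative_mult D2 that)
  have dH2: "(H2 has_derivative H2' p) (at p)" if "p \<in> S" for p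
    unfolding H2_def[abs_def] H2'_def[abs_def]
    by (intro has_derivative_mult_right has_derivative_mult D2 that)
  note cont = C2_continuous1[OF S C2] C2_continuous2[OF S C2]
  have cHt: "continuous_on S (\<lambda>p. Ht' p e3)"
    unfolding Ht'_def by (intro continuous_intros cont)
  have cH1: "continuous_on S (\<lambda>p. H1' p e1)"
    unfolding H1'_def by (intro continuous_intros cont)
  have cH2: "continuous_on S (\<lambda>p. H2' p e2)"
    unfolding H2'_def by (intro continuous_intros cont)
  note out' = out[unfolded q_def]
  define Gt where "Gt p = W p * Ht' p e3 + W' p e3 * Ht p" for p
  define G1 where "G1 p = W p * H1' p e1 + W' p e1 * H1 p" for p
  define G2 where "G2 p = W p * H2' p e2 + W' p e2 * H2 p" for p
  have cG: "continuous_on B G1" "continuous_on B G2" "continuous_on B Gt"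
    using cone_weight_cutoff_continuous[OF S dH1 out' cH1] cone_weight_cutoff_continuous[OF S dH2 out' cH2]
      cone_weight_cutoff_continuous[OF S dHt out' cHt]
    unfolding G1_def[abs_def] G2_def[abs_def] Gt_def[abs_def] W_def W'_def by blast+
  have d1: "((\<lambda>x. W ((x, y), t) * H1 ((x, y), t)) has_real_derivative G1 ((x, y), t)) (at x)"
    if "((x, y), t) \<in> B" for x y t
    using has_derivative_along_line[of "\<lambda>p. W p * H1 p" _ "((0, y), t)" x e1]
      cone_weight_cutoff_derivative[OF S dH1 out' cH1 that]
    by (simp add: e1_def G1_def W_def W'_def)
  have d2: "((\<lambda>y. W ((x, y), t) * H2 ((x, y), t)) has_real_derivative G2 ((x, y), t)) (at y)"
    if "((x, y), t) \<in> B" for x y t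
    using has_derivative_along_line[of "\<lambda>p. W p * H2 p" _ "((x, 0), t)" y e2]
      cone_weight_cutoff_derivative[OF S dH2 out' cH2 that]
    by (simp add: e2_def G2_def W_def W'_def)
  have d3: "((\<lambda>t. W ((x, y), t) * Ht ((x, y), t)) has_real_derivative Gt ((x, y), t)) (at t)"
    if "((x, y), t) \<in> B" for x y t
    using has_derivative_along_line[of "\<lambda>p. W p * Ht p" _ "((x, y), 0)" t e3]
      cone_weight_cutoff_derivative[OF S dHt out' cHt that]
    by (simp add: e3_def Gt_def W_def W'_def)
  have W0: "W p = 0" if "q p \<le> 0" for p
    using that by (simp add: W_def q_def cone_weight_def)
  have side: "r \<le> norm ((x, y) - x0)"
    if "x = fst x0 - r \<or> x = fst x0 + r \<or> y = snd x0 - r \<or> y = snd x0 + r" for x y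
  proof -
    have "(x, y) - x0 = (x - fst x0, y - snd x0)" by (simp add: prod_eq_iff)
    then show ?thesis
      using that rpos norm_fst_le[of "x - fst x0" "y - snd x0"] norm_snd_le[of "y - snd x0" "x - fst x0"]
      by auto
  qed
  have zero_initially: "dir_deriv U v (x, \<alpha>) = 0" if "x \<in> ball x0 r" for x v
  proof -
    have "((\<lambda>p. 0) has_derivative (\<lambda>h. 0)) (at (x, \<alpha>))" by simp
    then have "(U has_derivative (\<lambda>h. 0)) (at (x, \<alpha>))"
      by (rule has_derivative_transform_within_open[of _ _ _ _ "ball x0 r \<times> {0<..<\<tau>}"])
        (use that \<alpha> zero in \<open>auto simp: U_def open_Times simp del: mem_ball\<close>)
    from frechet_derivative_at[OF this] show ?thesis by (metis (full_types))
  qed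
  have initial: "W (x, \<alpha>) * Ht (x, \<alpha>) = 0" for x
  proof (cases "x \<in> ball x0 r")
    case True
    then show ?thesis by (simp add: Ht_def zero_initially)
  next
    case False
    then have "q (x, \<alpha>) < 0" using \<alpha> by (intro q_neg) (auto simp: dist_norm norm_minus_commute)
    then show ?thesis by (simp add: W0)
  qed
  have terminal: "W (x, T) = 0" for x
    by (rule W0) (simp add: q_def cone_fun_def)
  have int0: "integral B (\<lambda>p. G1 p + G2 p + Gt p) = 0"
  proof (rule divergence_theorem_zero_flux[where Hx="\<lambda>p. W p * H1 p" and Hy="\<lambda>p. W p * H2 p"
        and Ht="\<lambda>p. W p * Ht p" and ?a1.0="fst x0 - r" and ?a2.0="snd x0 - r" and \<alpha>=\<alpha>
        and ?b1.0="fst x0 + r" and ?b2.0="snd x0 + r" and \<beta>=T, folded B_def])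
    show "W ((x, y), t) * H1 ((x, y), t) = 0"
      if "((x, y), t) \<in> B" "x = fst x0 - r \<or> x = fst x0 + r" for x y t
    proof -
      have "q ((x, y), t) < 0" using that(2) by (intro q_neg[OF tpos[OF that(1)]] side) auto
      then show ?thesis by (simp add: W0)
    qed
    show "W ((x, y), t) * H2 ((x, y), t) = 0"
      if "((x, y), t) \<in> B" "y = snd x0 - r \<or> y = snd x0 + r" for x y t
    proof -
      have "q ((x, y), t) < 0" using that(2) by (intro q_neg[OF tpos[OF that(1)]] side) auto
      then show ?thesis by (simp add: W0)
    qed
    show "W ((x, y), t) * Ht ((x, y), t) = 0"
      if "((x, y), t) \<in> B" "t = \<alpha> \<or> t = T" for x y t
      using that(2) initial terminal by auto
  qed (use rpos \<alpha> cG d1 d2 d3 in auto)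
  \<comment> \<open>By the wave equation, and since mixed derivatives commute, the current itself is free of divergence;
    what remains are the derivatives of the weight.\<close>
  have wave': "dir_deriv ?ut e3 p = c\<^sup>2 * (dir_deriv ?u1 e1 p + dir_deriv ?u2 e2 p)" if "p \<in> S" for p
  proof -
    have "(\<Sum>i\<in>Basis. dir_deriv (dir_deriv U (i, 0)) (i, 0) p) = dir_deriv ?u1 e1 p + dir_deriv ?u2 e2 p"
      by (simp add: Basis_prod_def e1_def e2_def sum.union_disjoint sum.reindex inj_on_def disjoint_iff)
    then show ?thesis
      using wave wave_equation_spacetime[of "ball x0 r" "{0<..}" u c] C2 that
      by (cases p) (auto simp: S_def U_def e3_def)
  qed
  have div: "G1 p + G2 p + Gt p = W' p e3 * Ht p - c\<^sup>2 * ?ut p * (W' p e1 * ?u1 p + W' p e2 * ?u2 p)"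
    if "p \<in> B" for p
  proof (cases "p \<in> S")
    case True
    note sym = mixed_derivatives_commute[OF S C2 True]
    have "Ht' p e3 + H1' p e1 + H2' p e2 = 0"
      unfolding Ht'_def H1'_def H2'_def wave'[OF True] sym[of e3 e1] sym[of e3 e2]
      by (simp add: algebra_simps)
    then have "W p * Ht' p e3 + W p * H1' p e1 + W p * H2' p e2 = 0"
      by (metis distrib_left mult_zero_right)
    then show ?thesis
      unfolding G1_def G2_def Gt_def by (simp add: H1_def H2_def algebra_simps)
  next
    case False
    have "W' p h = 0" for h
      using out[OF that False] by (simp add: W'_def cone_weight'_def q_def)
    then show ?thesis by (simp add: G1_def G2_def Gt_def W0 less_imp_le[OF out[OF that False]])
  qed
  have W'_eq: "W' p e3 = - 4 * max 0 (q p) * (c\<^sup>2 * (T - snd p))"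
    "W' p e1 = - 4 * max 0 (q p) * (fst (fst p) - fst x0)"
    "W' p e2 = - 4 * max 0 (q p) * (snd (fst p) - snd x0)" for p
    unfolding W'_def cone_weight'_def cone_fun'_def q_def e1_def e2_def e3_def inner_prod_def
    by (simp_all add: algebra_simps)
  have div': "G1 p + G2 p + Gt p = 4 * c\<^sup>2 * max 0 (q p) *
      (?ut p * ((fst (fst p) - fst x0) * ?u1 p + (snd (fst p) - snd x0) * ?u2 p) - (T - snd p) * Ht p)"
    if "p \<in> B" for p
    unfolding div[OF that] W'_eq by (simp add: algebra_simps)
  have nonpos: "G1 p + G2 p + Gt p \<le> 0" if p: "p \<in> B" for p
  proof (cases "q p > 0")
    case True
    have "(fst (fst p) - fst x0)\<^sup>2 + (snd (fst p) - snd x0)\<^sup>2 \<le> c\<^sup>2 * (T - snd p)\<^sup>2"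
      using True by (simp add: q_def cone_fun_def norm_prod_def)
    then have "?ut p * ((fst (fst p) - fst x0) * ?u1 p + (snd (fst p) - snd x0) * ?u2 p) - (T - snd p) * Ht p \<le> 0"
      using flux_bound[OF c, of "T - snd p"] tpos[of "fst p" "snd p"] p by (simp add: Ht_def)
    then show ?thesis
      unfolding div'[OF p] by (intro mult_nonneg_nonpos) auto
  next
    case False
    then show ?thesis unfolding div'[OF p] by simp
  qed
  have axis: "(x0, s) \<in> B"
    using rpos s by (cases x0) (simp add: B_def cbox_Pair_eq)
  have "- (G1 (x0, s) + G2 (x0, s) + Gt (x0, s)) = 0"
  proof (rule has_integral_0_cbox_imp_0[where a="((fst x0 - r, snd x0 - r), \<alpha>)"
        and b="((fst x0 + r, snd x0 + r), T)" and f="\<lambda>p. - (G1 p + G2 p + Gt p)", folded B_def])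
    show "continuous_on B (\<lambda>p. - (G1 p + G2 p + Gt p))"
      by (intro continuous_intros cG)
    show "((\<lambda>p. - (G1 p + G2 p + Gt p)) has_integral 0) B"
    proof -
      have "(\<lambda>p. G1 p + G2 p + Gt p) integrable_on B"
        unfolding B_def by (intro integrable_continuous continuous_intros cG[unfolded B_def])
      then have "((\<lambda>p. G1 p + G2 p + Gt p) has_integral 0) B"
        using int0 by (simp add: has_integral_iff)
      from has_integral_neg[OF this] show ?thesis by simp
    qed
    show "box ((fst x0 - r, snd x0 - r), \<alpha>) ((fst x0 + r, snd x0 + r), T) \<noteq> {}"
      using rpos \<alpha> by (simp add: box_ne_empty Basis_prod_def)
    show "0 \<le> - (G1 p + G2 p + Gt p)" if "p \<in> box ((fst x0 - r, snd x0 - r), \<alpha>) ((fst x0 + r, snd x0 + r), T)" for p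
      using nonpos[of p] that box_subset_cbox unfolding B_def by fastforce
  qed (use axis B_def in auto)
  then have "4 * c\<^sup>2 * max 0 (q (x0, s)) * ((T - s) * Ht (x0, s)) = 0"
    using div'[OF axis] by simp
  moreover have "q (x0, s) > 0"
    using c s by (simp add: q_def cone_fun_def)
  ultimately have "Ht (x0, s) = 0" using c s by simp
  then have "(?ut (x0, s))\<^sup>2 + c\<^sup>2 * ((?u1 (x0, s))\<^sup>2 + (?u2 (x0, s))\<^sup>2) = 0"
    by (simp add: Ht_def)
  moreover have "c\<^sup>2 * ((?u1 (x0, s))\<^sup>2 + (?u2 (x0, s))\<^sup>2) \<ge> 0" by simp
  ultimately have "(?ut (x0, s))\<^sup>2 \<le> 0" by linarith
  then show ?thesis by (simp add: U_def e3_def)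
qed

text \<open>On the axis of the cone the wave is constant in time, because the energy density dominates
  its time derivative, and it starts from zero.\<close>

lemma finite_propagation_speed:
  assumes c: "c > 0" and r: "r > 0" and \<tau>: "\<tau> > 0"
    and C2: "Ck_on 2 (ball x0 r \<times> {0<..}) (spacetime u)"
    and wave: "wave_equation (ball x0 r) {0<..} c u"
    and zero: "\<And>x t. x \<in> ball x0 r \<Longrightarrow> 0 < t \<Longrightarrow> t < \<tau> \<Longrightarrow> u x t = 0"
    and t: "0 < t" "t < \<tau> + r / c"
  shows "u x0 t = 0"
proof -
  \<comment> \<open>There is room for a cone with apex later than \<open>t\<close> and base at a time \<open>\<alpha>\<close> at which, and shortly
    after which, the wave still vanishes.\<close>
  obtain T where T: "max t \<tau> < T" "T < \<tau> + r / c"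
    using dense[of "max t \<tau>" "\<tau> + r / c"] t r c by auto
  obtain \<alpha> where "max 0 (T - r / c) < \<alpha>" "\<alpha> < \<tau>"
    using dense[of "max 0 (T - r / c)" \<tau>] T \<tau> by auto
  then have \<alpha>: "0 < \<alpha>" "\<alpha> < \<tau>" "c * (T - \<alpha>) < r"
    using c by (auto simp: field_simps)
  have x0: "x0 \<in> ball x0 r" using r by simp
  have der: "(u x0 has_real_derivative dir_deriv (spacetime u) (0, 1) (x0, s)) (at s)" if "0 < s" for s
    by (rule time_slice_derivative[OF _ _ C2]) (use that x0 in auto)
  show ?thesis
  proof (cases "t \<le> \<alpha>")
    case True
    then show ?thesis using zero[OF x0] t \<alpha> by simp
  next
    case False
    have "u x0 t = u x0 \<alpha>"
    proof (rule DERIV_isconst_end[of \<alpha> t "u x0"])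
      show "continuous_on {\<alpha>..t} (u x0)"
        using der \<alpha> by (intro DERIV_continuous_on[of _ _ "\<lambda>s. dir_deriv (spacetime u) (0, 1) (x0, s)"])
          (auto intro: has_field_derivative_at_within)
      show "DERIV (u x0) s :> 0" if "\<alpha> < s" "s < t" for s
        using der[of s] energy_vanishes_on_axis[OF c \<alpha>(1,2) _ \<alpha>(3) C2 wave zero, of s] that T \<alpha> by auto
    qed (use False in simp)
    then show ?thesis using zero[OF x0 \<alpha>(1,2)] by simp
  qed
qed

section \<open>Position of the interfaces\<close>

lemma connected_subset_upper_domain:
  assumes "x \<in> upper_domain \<Gamma>" "x \<in> C" "connected C" "C \<inter> \<Gamma> = {}"
  shows "C \<subseteq> upper_domain \<Gamma>"
proof
  fix y assume "y \<in> C"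
  then have "connected_component (- \<Gamma>) y x"
    using assms by (auto simp: connected_component_def intro!: exI[of _ C])
  then show "y \<in> upper_domain \<Gamma>"
    using assms(1) unfolding upper_domain_def by (blast intro: connected_component_trans)
qed

lemma connected_subset_lower_domain:
  assumes "x \<in> lower_domain \<Gamma>" "x \<in> C" "connected C" "C \<inter> \<Gamma> = {}"
  shows "C \<subseteq> lower_domain \<Gamma>"
proof
  fix y assume "y \<in> C"
  then have "connected_component (- \<Gamma>) y x"
    using assms by (auto simp: connected_component_def intro!: exI[of _ C])
  then show "y \<in> lower_domain \<Gamma>"
    using assms(1) unfolding lower_domain_def by (blast intro: connected_component_trans)
qed

lemma upper_domain_disjoint: "x \<in> \<Gamma> \<Longrightarrow> x \<notin> upper_domain \<Gamma>"
  unfolding upper_domain_def using connected_component_in by fastforce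

lemma lower_domain_disjoint: "x \<in> \<Gamma> \<Longrightarrow> x \<notin> lower_domain \<Gamma>"
  unfolding lower_domain_def using connected_component_in by fastforce

lemma open_upper_domain:
  assumes "closed \<Gamma>"
  shows "open (upper_domain \<Gamma>)"
proof (subst open_subopen, rule ballI)
  fix x assume x: "x \<in> upper_domain \<Gamma>"
  have "open (- \<Gamma>)" "x \<in> - \<Gamma>"
    using assms x upper_domain_disjoint[of x \<Gamma>] by auto
  then obtain e where "e > 0" "ball x e \<subseteq> - \<Gamma>"
    by (rule openE)
  then show "\<exists>T. open T \<and> x \<in> T \<and> T \<subseteq> upper_domain \<Gamma>"
    by (intro exI[of _ "ball x e"] conjI connected_subset_upper_domain[OF x]) auto
qed

lemma open_lower_domain:
  assumes "closed \<Gamma>"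
  shows "open (lower_domain \<Gamma>)"
proof (subst open_subopen, rule ballI)
  fix x assume x: "x \<in> lower_domain \<Gamma>"
  have "open (- \<Gamma>)" "x \<in> - \<Gamma>"
    using assms x lower_domain_disjoint[of x \<Gamma>] by auto
  then obtain e where "e > 0" "ball x e \<subseteq> - \<Gamma>"
    by (rule openE)
  then show "\<exists>T. open T \<and> x \<in> T \<and> T \<subseteq> lower_domain \<Gamma>"
    by (intro exI[of _ "ball x e"] conjI connected_subset_lower_domain[OF x]) auto
qed

text \<open>The sign \<open>\<sigma>\<close> selects a side, 1 for above and -1 for below \<open>\<Gamma>\<close>. A point of \<open>\<Gamma>'\<close> is joined within \<open>\<Gamma>'\<close> to its flat part far to the
  right, where one can move away vertically without meeting \<open>\<Gamma>\<close>, and then back to the axis.\<close>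

lemma interface_connected_to_axis:
  assumes I: "lipschitz_interface h \<Gamma>" and I': "lipschitz_interface h' \<Gamma>'" and disj: "\<Gamma> \<inter> \<Gamma>' = {}"
    and \<sigma>: "\<sigma> = 1 \<or> \<sigma> = - 1" and h: "0 < \<sigma> * (h' - h)" and x: "x \<in> \<Gamma>'"
  shows "\<exists>K. \<forall>s\<ge>K. connected_component (- \<Gamma>) x (0, \<sigma> * s)"
proof -
  obtain R R' where R: "\<And>y. R < norm y \<Longrightarrow> y \<in> \<Gamma> \<longleftrightarrow> snd y = h"
    and R': "\<And>y. R' < norm y \<Longrightarrow> y \<in> \<Gamma>' \<longleftrightarrow> snd y = h'"
    using I I' unfolding lipschitz_interface_def by metis
  define K where "K = 1 + \<bar>R\<bar> + \<bar>R'\<bar> + \<bar>h\<bar> + \<bar>h'\<bar>"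
  have nfst: "\<bar>fst y\<bar> \<le> norm y" and nsnd: "\<bar>snd y\<bar> \<le> norm y" for y :: plane
    using norm_fst_le[of "fst y" "snd y"] norm_snd_le[of "snd y" "fst y"] by auto
  have P: "(K, h') \<in> \<Gamma>'"
  proof -
    have "R' < K" unfolding K_def by linarith
    moreover have "\<bar>K\<bar> \<le> norm (K, h')" using nfst[of "(K, h')"] by simp
    ultimately have "R' < norm (K, h')" by linarith
    then show ?thesis using R' by simp
  qed
  have c1: "connected_component (- \<Gamma>) x (K, h')"
    unfolding connected_component_def
    using P x disj I' by (intro exI[of _ \<Gamma>']) (auto simp: lipschitz_interface_def)
  show ?thesis
  proof (intro exI allI impI)
    fix s assume s: "K \<le> s"
    \<comment> \<open>Two convex sets which avoid \<open>\<Gamma>\<close>: the part far to the right and beyond the flat part of \<open>\<Gamma>\<close>, and a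
      half-plane beyond all of \<open>\<Gamma>\<close>. They meet in \<open>(K, \<sigma> * s)\<close>.\<close>
    define A where "A = {K..} \<times> (if \<sigma> = 1 then {h<..} else {..<h})"
    define B :: "plane set" where "B = UNIV \<times> (if \<sigma> = 1 then {K..} else {..-K})"
    have A: "A \<subseteq> - \<Gamma>"
    proof
      fix y assume "y \<in> A"
      then have "R < norm y" "snd y \<noteq> h"
        using nfst[of y] by (auto simp: A_def K_def split: if_splits)
      then show "y \<in> - \<Gamma>" using R by simp
    qed
    have B: "B \<subseteq> - \<Gamma>"
    proof
      fix y assume "y \<in> B"
      then have "R < norm y" "snd y \<noteq> h"
        using nsnd[of y] by (auto simp: B_def K_def split: if_splits)
      then show "y \<in> - \<Gamma>" using R by simp
    qed
    have "convex A" "convex B"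
      unfolding A_def B_def by (auto intro!: convex_Times)
    then have conn: "connected A" "connected B" by (auto intro: convex_connected)
    have c2: "connected_component (- \<Gamma>) (K, h') (K, \<sigma> * s)"
      unfolding connected_component_def
      using A conn \<sigma> h s by (intro exI[of _ A]) (auto simp: A_def K_def)
    have c3: "connected_component (- \<Gamma>) (K, \<sigma> * s) (0, \<sigma> * s)"
      unfolding connected_component_def
      using B conn \<sigma> s by (intro exI[of _ B]) (auto simp: B_def)
    show "connected_component (- \<Gamma>) x (0, \<sigma> * s)"
      using c1 c2 c3 by (blast intro: connected_component_trans)
  qed
qed

lemma interface_below:
  assumes "lipschitz_interface h \<Gamma>" "lipschitz_interface h' \<Gamma>'" "\<Gamma> \<inter> \<Gamma>' = {}" "h' < h"
  shows "\<Gamma>' \<subseteq> lower_domain \<Gamma>"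
  using interface_connected_to_axis[OF assms(1-3), of "-1"] assms(4)
  by (auto simp: lower_domain_def)

lemma interface_above:
  assumes "lipschitz_interface h \<Gamma>" "lipschitz_interface h' \<Gamma>'" "\<Gamma> \<inter> \<Gamma>' = {}" "h < h'"
  shows "\<Gamma>' \<subseteq> upper_domain \<Gamma>"
  using interface_connected_to_axis[OF assms(1-3), of 1] assms(4)
  by (auto simp: upper_domain_def)

lemma ball_subset_lower_domain:
  assumes "\<Gamma>' \<subseteq> lower_domain \<Gamma>" "x \<in> \<Gamma>'" "0 < setdist \<Gamma> \<Gamma>'"
  shows "ball x (setdist \<Gamma> \<Gamma>') \<subseteq> lower_domain \<Gamma>"
proof (rule connected_subset_lower_domain[of x])
  show "ball x (setdist \<Gamma> \<Gamma>') \<inter> \<Gamma> = {}"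
    using setdist_le_dist[OF _ assms(2)] by (fastforce simp: dist_commute)
qed (use assms in auto)

lemma ball_subset_upper_domain:
  assumes "\<Gamma>' \<subseteq> upper_domain \<Gamma>" "x \<in> \<Gamma>'" "0 < setdist \<Gamma>' \<Gamma>"
  shows "ball x (setdist \<Gamma>' \<Gamma>) \<subseteq> upper_domain \<Gamma>"
proof (rule connected_subset_upper_domain[of x])
  show "ball x (setdist \<Gamma>' \<Gamma>) \<inter> \<Gamma> = {}"
    using setdist_le_dist[OF assms(2)] by fastforce
qed (use assms in auto)

section \<open>Boundary values and transmission conditions\<close>

text \<open>In a smaller domain a point is closer to the complement, so its approach regions are smaller,
  too. This turns boundary values in an upper or lower domain into boundary values in a layer.\<close>

lemma nt_limit_mono:
  assumes "nt_limit D' x \<phi> l" "D \<subseteq> D'" "x \<notin> D'"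
  shows "nt_limit D x \<phi> l"
  unfolding nt_limit_def
proof (intro allI impI)
  fix \<kappa> :: real assume \<kappa>: "\<kappa> > 0"
  have le: "infdist y (- D) \<le> infdist y (- D')" for y
    using assms(2,3) by (intro infdist_mono) auto
  have "(1 + \<kappa>) * infdist y (- D) \<le> (1 + \<kappa>) * infdist y (- D')" for y
    using \<kappa> by (intro mult_left_mono le) auto
  then have "{y \<in> D. dist y x < (1 + \<kappa>) * infdist y (- D)} \<subseteq> {y \<in> D'. dist y x < (1 + \<kappa>) * infdist y (- D')}"
    using assms(2) by (auto intro: less_le_trans)
  then show "(\<phi> \<longlongrightarrow> l) (at x within {y \<in> D. dist y x < (1 + \<kappa>) * infdist y (- D)})"
    by (rule tendsto_within_subset[OF assms(1)[unfolded nt_limit_def, rule_format, OF \<kappa>]])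
qed

lemma nt_limit_cong:
  assumes "nt_limit D x \<phi> l" "\<And>y. y \<in> D \<Longrightarrow> \<phi> y = \<psi> y"
  shows "nt_limit D x \<psi> l"
  unfolding nt_limit_def
proof (intro allI impI)
  fix \<kappa> :: real assume \<kappa>: "\<kappa> > 0"
  show "(\<psi> \<longlongrightarrow> l) (at x within {y \<in> D. dist y x < (1 + \<kappa>) * infdist y (- D)})"
    by (rule Lim_transform_eventually[OF assms(1)[unfolded nt_limit_def, rule_format, OF \<kappa>]])
      (auto simp: eventually_at_filter assms(2))
qed

lemma nt_limit_add:
  "nt_limit D x \<phi> l \<Longrightarrow> nt_limit D x \<psi> m \<Longrightarrow> nt_limit D x (\<lambda>y. \<phi> y + \<psi> y) (l + m)"
  unfolding nt_limit_def by (auto intro: tendsto_add)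

lemma nt_limit_continuous:
  assumes "continuous_on E \<phi>" "open E" "x \<in> E"
  shows "nt_limit D x \<phi> (\<phi> x)"
  using assms unfolding nt_limit_def
  by (auto simp: continuous_on_eq_continuous_at isCont_def intro: tendsto_within_subset)

lemma arclength_null_empty: "arclength_null {}"
  unfolding arclength_null_def by (auto intro!: exI[of _ "\<lambda>_. {}"])

lemma arclength_null_Un:
  assumes "arclength_null Y" "arclength_null Z"
  shows "arclength_null (Y \<union> Z)"
  unfolding arclength_null_def
proof (intro allI impI)
  fix \<epsilon> :: real assume "\<epsilon> > 0"
  then have e2: "\<epsilon> / 2 > 0" by simp
  obtain B where B: "Y \<subseteq> (\<Union>i. B i)" "\<And>i. bounded (B i)"
    "(\<Sum>i. ennreal (diameter (B i))) < ennreal (\<epsilon> / 2)"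
    using assms(1) e2 unfolding arclength_null_def by metis
  obtain C where C: "Z \<subseteq> (\<Union>i. C i)" "\<And>i. bounded (C i)"
    "(\<Sum>i. ennreal (diameter (C i))) < ennreal (\<epsilon> / 2)"
    using assms(2) e2 unfolding arclength_null_def by metis
  \<comment> \<open>The two covers are interleaved; their total diameters add up.\<close>
  define E where "E n = (if even n then B (n div 2) else C (n div 2))" for n :: nat
  have partial: "(\<Sum>i<2 * n. ennreal (diameter (E i)))
      = (\<Sum>i<n. ennreal (diameter (B i))) + (\<Sum>i<n. ennreal (diameter (C i)))" for n
    by (induction n) (simp_all add: E_def ac_simps)
  have "(\<Sum>i. ennreal (diameter (E i))) \<le> (\<Sum>i. ennreal (diameter (B i))) + (\<Sum>i. ennreal (diameter (C i)))"
  proof (rule suminf_le_const[OF summableI])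
    fix n
    have "(\<Sum>i<n. ennreal (diameter (E i))) \<le> (\<Sum>i<2 * n. ennreal (diameter (E i)))"
      by (rule sum_mono2) auto
    also have "\<dots> \<le> (\<Sum>i. ennreal (diameter (B i))) + (\<Sum>i. ennreal (diameter (C i)))"
      unfolding partial by (intro add_mono sum_le_suminf summableI) auto
    finally show "(\<Sum>i<n. ennreal (diameter (E i))) \<le> (\<Sum>i. ennreal (diameter (B i))) + (\<Sum>i. ennreal (diameter (C i)))" .
  qed
  also have "\<dots> < ennreal (\<epsilon> / 2) + ennreal (\<epsilon> / 2)"
    using B(3) C(3) by (rule add_strict_mono)
  also have "\<dots> = ennreal \<epsilon>"
    using \<open>\<epsilon> > 0\<close> by (simp flip: ennreal_plus)
  finally have "(\<Sum>i. ennreal (diameter (E i))) < ennreal \<epsilon>" .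
  moreover have "B i \<subseteq> (\<Union>i. E i)" "C i \<subseteq> (\<Union>i. E i)" for i
    using UN_upper[of "2 * i" UNIV E] UN_upper[of "Suc (2 * i)" UNIV E] by (simp_all add: E_def)
  then have "(\<Union>i. B i) \<subseteq> (\<Union>i. E i)" "(\<Union>i. C i) \<subseteq> (\<Union>i. E i)"
    by (simp_all only: UN_least)
  then have "Y \<union> Z \<subseteq> (\<Union>i. E i)"
    using B(1) C(1) by (meson Un_least order_trans)
  moreover have "bounded (E i)" for i using B(2) C(2) by (simp add: E_def)
  ultimately show "\<exists>B. Y \<union> Z \<subseteq> (\<Union>i. B i) \<and> (\<forall>i. bounded (B i)) \<and>
      (\<Sum>i. ennreal (diameter (B i))) < ennreal \<epsilon>"
    by blast
qed

lemma transmission_conditions_subset: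
  assumes "transmission_conditions \<Gamma> J A \<rho>a ua B \<rho>b ub f g"
    and "J' \<subseteq> J" "A' \<subseteq> A" "B' \<subseteq> B" "\<And>x. x \<in> \<Gamma> \<Longrightarrow> x \<notin> A \<and> x \<notin> B"
    and "\<And>x t. x \<in> \<Gamma> \<Longrightarrow> t \<in> J' \<Longrightarrow> f x t = f' x t \<and> g x t = g' x t"
  shows "transmission_conditions \<Gamma> J' A' \<rho>a ua B' \<rho>b ub f' g'"
  unfolding transmission_conditions_def
proof
  fix t assume t: "t \<in> J'"
  then obtain Z where Z: "arclength_null Z" and *: "\<And>x. x \<in> \<Gamma> - Z \<Longrightarrow> \<exists>a b a' b'.
        nt_limit A x (\<lambda>y. ua y t) a \<and>
        nt_limit B x (\<lambda>y. ub y t) b \<and>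
        nt_limit A x (\<lambda>y. frechet_derivative (\<lambda>z. ua z t) (at y) (unit_normal \<Gamma> x)) a' \<and>
        nt_limit B x (\<lambda>y. frechet_derivative (\<lambda>z. ub z t) (at y) (unit_normal \<Gamma> x)) b' \<and>
        b - a = f x t \<and> b' / \<rho>b - a' / \<rho>a = g x t"
    using assms(1,2) unfolding transmission_conditions_def by (meson subsetD)
  show "\<exists>Z. arclength_null Z \<and> (\<forall>x\<in>\<Gamma> - Z. \<exists>a b a' b'.
        nt_limit A' x (\<lambda>y. ua y t) a \<and>
        nt_limit B' x (\<lambda>y. ub y t) b \<and>
        nt_limit A' x (\<lambda>y. frechet_derivative (\<lambda>z. ua z t) (at y) (unit_normal \<Gamma> x)) a' \<and>
        nt_limit B' x (\<lambda>y. frechet_derivative (\<lambda>z. ub z t) (at y) (unit_normal \<Gamma> x)) b' \<and>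
        b - a = f' x t \<and> b' / \<rho>b - a' / \<rho>a = g' x t)"
  proof (intro exI[of _ Z] conjI ballI Z)
    fix x assume x: "x \<in> \<Gamma> - Z"
    have m: "nt_limit A x \<phi> l \<Longrightarrow> nt_limit A' x \<phi> l" "nt_limit B x \<phi> l \<Longrightarrow> nt_limit B' x \<phi> l" for \<phi> l
      using nt_limit_mono[of A x \<phi> l A'] nt_limit_mono[of B x \<phi> l B'] assms(3,4,5) x by auto
    obtain a b a' b' where "nt_limit A x (\<lambda>y. ua y t) a" "nt_limit B x (\<lambda>y. ub y t) b"
      "nt_limit A x (\<lambda>y. frechet_derivative (\<lambda>z. ua z t) (at y) (unit_normal \<Gamma> x)) a'"
      "nt_limit B x (\<lambda>y. frechet_derivative (\<lambda>z. ub z t) (at y) (unit_normal \<Gamma> x)) b'"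
      "b - a = f x t" "b' / \<rho>b - a' / \<rho>a = g x t"
      using *[OF x] by blast
    then show "\<exists>a b a' b'.
        nt_limit A' x (\<lambda>y. ua y t) a \<and>
        nt_limit B' x (\<lambda>y. ub y t) b \<and>
        nt_limit A' x (\<lambda>y. frechet_derivative (\<lambda>z. ua z t) (at y) (unit_normal \<Gamma> x)) a' \<and>
        nt_limit B' x (\<lambda>y. frechet_derivative (\<lambda>z. ub z t) (at y) (unit_normal \<Gamma> x)) b' \<and>
        b - a = f' x t \<and> b' / \<rho>b - a' / \<rho>a = g' x t"
      using assms(6)[OF _ t, of x] x m
      by (intro exI[of _ a] exI[of _ b] exI[of _ a'] exI[of _ b']) auto
  qed
qed

lemma transmission_conditions_add:
  assumes u: "transmission_conditions \<Gamma> J A \<rho>a ua B \<rho>b ub f g"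
    and v: "transmission_conditions \<Gamma> J A \<rho>a va B \<rho>b vb f' g'"
    and dA: "\<And>y t. y \<in> A \<Longrightarrow> t \<in> J \<Longrightarrow> (\<lambda>z. ua z t) differentiable (at y) \<and> (\<lambda>z. va z t) differentiable (at y)"
    and dB: "\<And>y t. y \<in> B \<Longrightarrow> t \<in> J \<Longrightarrow> (\<lambda>z. ub z t) differentiable (at y) \<and> (\<lambda>z. vb z t) differentiable (at y)"
  shows "transmission_conditions \<Gamma> J A \<rho>a (\<lambda>x t. ua x t + va x t) B \<rho>b (\<lambda>x t. ub x t + vb x t)
    (\<lambda>x t. f x t + f' x t) (\<lambda>x t. g x t + g' x t)"
  unfolding transmission_conditions_def
proof
  fix t assume t: "t \<in> J"
  obtain Y where Y: "arclength_null Y" and u': "\<And>x. x \<in> \<Gamma> - Y \<Longrightarrow> \<exists>a b a' b'.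
        nt_limit A x (\<lambda>y. ua y t) a \<and> nt_limit B x (\<lambda>y. ub y t) b \<and>
        nt_limit A x (\<lambda>y. frechet_derivative (\<lambda>z. ua z t) (at y) (unit_normal \<Gamma> x)) a' \<and>
        nt_limit B x (\<lambda>y. frechet_derivative (\<lambda>z. ub z t) (at y) (unit_normal \<Gamma> x)) b' \<and>
        b - a = f x t \<and> b' / \<rho>b - a' / \<rho>a = g x t"
    using u t unfolding transmission_conditions_def by meson
  obtain Z where Z: "arclength_null Z" and v': "\<And>x. x \<in> \<Gamma> - Z \<Longrightarrow> \<exists>a b a' b'.
        nt_limit A x (\<lambda>y. va y t) a \<and> nt_limit B x (\<lambda>y. vb y t) b \<and>
        nt_limit A x (\<lambda>y. frechet_derivative (\<lambda>z. va z t) (at y) (unit_normal \<Gamma> x)) a' \<and>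
        nt_limit B x (\<lambda>y. frechet_derivative (\<lambda>z. vb z t) (at y) (unit_normal \<Gamma> x)) b' \<and>
        b - a = f' x t \<and> b' / \<rho>b - a' / \<rho>a = g' x t"
    using v t unfolding transmission_conditions_def by meson
  show "\<exists>Z. arclength_null Z \<and> (\<forall>x\<in>\<Gamma> - Z. \<exists>a b a' b'.
        nt_limit A x (\<lambda>y. ua y t + va y t) a \<and> nt_limit B x (\<lambda>y. ub y t + vb y t) b \<and>
        nt_limit A x (\<lambda>y. frechet_derivative (\<lambda>z. ua z t + va z t) (at y) (unit_normal \<Gamma> x)) a' \<and>
        nt_limit B x (\<lambda>y. frechet_derivative (\<lambda>z. ub z t + vb z t) (at y) (unit_normal \<Gamma> x)) b' \<and>
        b - a = f x t + f' x t \<and> b' / \<rho>b - a' / \<rho>a = g x t + g' x t)"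
  proof (intro exI[of _ "Y \<union> Z"] conjI ballI arclength_null_Un Y Z)
    fix x assume x: "x \<in> \<Gamma> - (Y \<union> Z)"
    obtain a b a' b' where 1: "nt_limit A x (\<lambda>y. ua y t) a" "nt_limit B x (\<lambda>y. ub y t) b"
      "nt_limit A x (\<lambda>y. frechet_derivative (\<lambda>z. ua z t) (at y) (unit_normal \<Gamma> x)) a'"
      "nt_limit B x (\<lambda>y. frechet_derivative (\<lambda>z. ub z t) (at y) (unit_normal \<Gamma> x)) b'"
      "b - a = f x t" "b' / \<rho>b - a' / \<rho>a = g x t"
      using u'[of x] x by auto
    obtain d e d' e' where 2: "nt_limit A x (\<lambda>y. va y t) d" "nt_limit B x (\<lambda>y. vb y t) e"
      "nt_limit A x (\<lambda>y. frechet_derivative (\<lambda>z. va z t) (at y) (unit_normal \<Gamma> x)) d'"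
      "nt_limit B x (\<lambda>y. frechet_derivative (\<lambda>z. vb z t) (at y) (unit_normal \<Gamma> x)) e'"
      "e - d = f' x t" "e' / \<rho>b - d' / \<rho>a = g' x t"
      using v'[of x] x by auto
    have "nt_limit A x (\<lambda>y. frechet_derivative (\<lambda>z. ua z t + va z t) (at y) (unit_normal \<Gamma> x)) (a' + d')"
      by (rule nt_limit_cong[OF nt_limit_add[OF 1(3) 2(3)]]) (simp add: dir_deriv_add dA t)
    moreover have "nt_limit B x (\<lambda>y. frechet_derivative (\<lambda>z. ub z t + vb z t) (at y) (unit_normal \<Gamma> x)) (b' + e')"
      by (rule nt_limit_cong[OF nt_limit_add[OF 1(4) 2(4)]]) (simp add: dir_deriv_add dB t)
    ultimately show "\<exists>a b a' b'.
        nt_limit A x (\<lambda>y. ua y t + va y t) a \<and> nt_limit B x (\<lambda>y. ub y t + vb y t) b \<and>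
        nt_limit A x (\<lambda>y. frechet_derivative (\<lambda>z. ua z t + va z t) (at y) (unit_normal \<Gamma> x)) a' \<and>
        nt_limit B x (\<lambda>y. frechet_derivative (\<lambda>z. ub z t + vb z t) (at y) (unit_normal \<Gamma> x)) b' \<and>
        b - a = f x t + f' x t \<and> b' / \<rho>b - a' / \<rho>a = g x t + g' x t"
      using nt_limit_add[OF 1(1) 2(1)] nt_limit_add[OF 1(2) 2(2)] 1(5,6) 2(5,6)
      by (intro exI[of _ "a + d"] exI[of _ "b + e"] exI[of _ "a' + d'"] exI[of _ "b' + e'"])
        (auto simp: add_divide_distrib)
  qed
qed

text \<open>Waves that are of class C^2 on a neighbourhood of \<open>\<Gamma>\<close> have their values as boundary values, from
  either side. The waves scattered at the neighbouring interfaces are of this kind.\<close>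

lemma transmission_conditions_smooth:
  assumes a: "open E" "\<Gamma> \<subseteq> E" "Ck_on 2 (E \<times> J) (spacetime ua)"
    and b: "open F" "\<Gamma> \<subseteq> F" "Ck_on 2 (F \<times> J) (spacetime ub)" and J: "open J"
  shows "transmission_conditions \<Gamma> J A \<rho>a ua B \<rho>b ub (\<lambda>x t. ub x t - ua x t)
    (\<lambda>x t. normal_deriv \<Gamma> ub x t / \<rho>b - normal_deriv \<Gamma> ua x t / \<rho>a)"
  unfolding transmission_conditions_def
proof (intro ballI exI[of _ "{}"] conjI arclength_null_empty)
  fix t x assume t: "t \<in> J" and "x \<in> \<Gamma> - {}"
  then have x: "x \<in> E" "x \<in> F" using a b by auto
  note ca = continuous_on_space_slice[OF a(1) J a(3) t] continuous_on_space_slice_derivative[OF a(1) J a(3) t]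
  note cb = continuous_on_space_slice[OF b(1) J b(3) t] continuous_on_space_slice_derivative[OF b(1) J b(3) t]
  show "\<exists>a b a' b'. nt_limit A x (\<lambda>y. ua y t) a \<and> nt_limit B x (\<lambda>y. ub y t) b \<and>
        nt_limit A x (\<lambda>y. frechet_derivative (\<lambda>z. ua z t) (at y) (unit_normal \<Gamma> x)) a' \<and>
        nt_limit B x (\<lambda>y. frechet_derivative (\<lambda>z. ub z t) (at y) (unit_normal \<Gamma> x)) b' \<and>
        b - a = ub x t - ua x t \<and>
        b' / \<rho>b - a' / \<rho>a = normal_deriv \<Gamma> ub x t / \<rho>b - normal_deriv \<Gamma> ua x t / \<rho>a"
    using nt_limit_continuous[OF ca(1) a(1) x(1)] nt_limit_continuous[OF ca(2) a(1) x(1)]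
      nt_limit_continuous[OF cb(1) b(1) x(2)] nt_limit_continuous[OF cb(2) b(1) x(2)]
    unfolding normal_deriv_def by blast
qed

section \<open>Solutions of the layered and two-layered problems\<close>

lemma wave_ivp_subset:
  assumes "wave_ivp X D J c u" "D' \<subseteq> D" "X D \<subseteq> X D'" "J' \<subseteq> J"
  shows "wave_ivp X D' J' c u"
proof -
  have "Ck_on 2 (D' \<times> J') (spacetime u)"
    by (rule Ck_on_subset[of _ "D \<times> J"]) (use assms in \<open>auto simp: wave_ivp_def\<close>)
  then show ?thesis
    using assms unfolding wave_ivp_def wave_equation_def by blast
qed

lemma wave_ivp_zero: "(\<lambda>x t. 0) \<in> X D \<Longrightarrow> wave_ivp X D J c (\<lambda>x t. 0)"
  by (simp add: wave_ivp_def Ck_on_zero wave_equation_def laplacian_def frechet_derivative_const)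

lemma wave_ivp_add:
  assumes "open D" "open J" "\<And>u v. u \<in> X D \<Longrightarrow> v \<in> X D \<Longrightarrow> (\<lambda>x t. u x t + v x t) \<in> X D"
    and u: "wave_ivp X D J c u" and v: "wave_ivp X D J c v"
  shows "wave_ivp X D J c (\<lambda>x t. u x t + v x t)"
  using u v Ck_on_add[OF open_Times[OF assms(1,2)], of 2 "spacetime u" "spacetime v"]
    wave_equation_add[OF assms(1,2), of u c v] assms(3)
  by (auto simp: wave_ivp_def intro!: derivative_eq_intros)

lemma transmission_conditions_zero:
  assumes "\<And>x t. x \<in> \<Gamma> \<Longrightarrow> t \<in> J \<Longrightarrow> f x t = 0 \<and> g x t = 0"
  shows "transmission_conditions \<Gamma> J A \<rho>a (\<lambda>x t. 0) B \<rho>b (\<lambda>x t. 0) f g"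
  unfolding transmission_conditions_def
  by (intro ballI exI[of _ "{}"] conjI arclength_null_empty exI[of _ 0])
    (use assms in \<open>auto simp: nt_limit_def\<close>)

lemma two_layered_problem_subset:
  fixes \<Gamma> :: "nat \<Rightarrow> plane set"
  assumes "two_layered_problem X \<Gamma> c \<rho> j J f g ua ub" "J' \<subseteq> J"
  shows "two_layered_problem X \<Gamma> c \<rho> j J' f g ua ub"
  using assms unfolding two_layered_problem_def
  by (auto intro: wave_ivp_subset transmission_conditions_subset
      dest: upper_domain_disjoint lower_domain_disjoint)

text \<open>The bound on \<open>t\<close> is strict, so that it still holds for slightly smaller balls around the
  points near \<open>x\<close>. The wave is zero at all these points, and this carries over to its gradient.\<close>

lemma finite_propagation_speed_gradient:
  assumes "c > 0" "r > 0" "\<tau> > 0" "ball x r \<subseteq> D" and u: "wave_ivp X D {0<..} c u"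
    and zero: "\<And>y t. y \<in> D \<Longrightarrow> 0 < t \<Longrightarrow> t < \<tau> \<Longrightarrow> u y t = 0"
    and t: "0 < t" "t < \<tau> + r / c"
  shows "u x t = 0" "frechet_derivative (\<lambda>y. u y t) (at x) v = 0"
proof -
  obtain r' where r': "max 0 (c * (t - \<tau>)) < r'" "r' < r"
    using dense[of "max 0 (c * (t - \<tau>))" r] assms t by (auto simp: field_simps)
  have z: "u y t = 0" if y: "y \<in> ball x (r - r')" for y
  proof (rule finite_propagation_speed[of c r' \<tau> y u])
    have sub: "ball y r' \<subseteq> D"
    proof
      fix z assume "z \<in> ball y r'"
      then have "dist x z < r"
        using y dist_triangle[of x z y] by simp
      then show "z \<in> D" using assms(4) by auto
    qed
    show "Ck_on 2 (ball y r' \<times> {0<..}) (spacetime u)"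
      by (rule Ck_on_subset[of _ "D \<times> {0<..}"]) (use u sub in \<open>auto simp: wave_ivp_def\<close>)
    show "wave_equation (ball y r') {0<..} c u"
      using u sub unfolding wave_ivp_def wave_equation_def by blast
    show "u x t = 0" if "x \<in> ball y r'" "0 < t" "t < \<tau>" for x t
      using zero that sub by blast
    show "t < \<tau> + r' / c" using r' \<open>c > 0\<close> by (simp add: field_simps)
  qed (use assms r' t in auto)
  have x: "x \<in> ball x (r - r')" using r' by simp
  then show "u x t = 0" by (rule z)
  have "((\<lambda>y. 0) has_derivative (\<lambda>h. 0)) (at x)" by simp
  then have "((\<lambda>y. u y t) has_derivative (\<lambda>h. 0)) (at x)"
    by (rule has_derivative_transform_within_open[OF _ open_ball x]) (simp only: z)
  from frechet_derivative_at[OF this] show "frechet_derivative (\<lambda>y. u y t) (at x) v = 0"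
    by metis
qed

locale multilayer =
  fixes N :: nat and \<Gamma> :: "nat \<Rightarrow> plane set" and c \<rho> :: "nat \<Rightarrow> real"
    and X :: "plane set \<Rightarrow> (plane \<Rightarrow> real \<Rightarrow> real) set"
  assumes N: "N \<ge> 3"
    and geometry: "layered_geometry N \<Gamma>"
    and c_pos: "j \<in> {1..N} \<Longrightarrow> c j > 0"
    and X: "uniqueness_class N \<Gamma> c \<rho> X"
begin

lemma X_zero: "(\<lambda>x t. 0) \<in> X D"
  and X_add: "u \<in> X D \<Longrightarrow> v \<in> X D \<Longrightarrow> (\<lambda>x t. u x t + v x t) \<in> X D"
  and X_restrict: "j \<in> {1..N-1} \<Longrightarrow> X (upper_domain (\<Gamma> j)) \<subseteq> X (layer N \<Gamma> j)"
    "j \<in> {1..N-1} \<Longrightarrow> X (lower_domain (\<Gamma> j)) \<subseteq> X (layer N \<Gamma> (Suc j))"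
  using X unfolding uniqueness_class_def by auto

lemma layered_problem_unique:
  assumes "T > 0" "layered_problem X N \<Gamma> c \<rho> {0<..<T} f g u" "layered_problem X N \<Gamma> c \<rho> {0<..<T} f g v"
    and "j \<in> {1..N}" "x \<in> layer N \<Gamma> j" "0 < t" "t < T"
  shows "u j x t = v j x t"
proof -
  have "\<forall>T>0. \<forall>f g u v.
        layered_problem X N \<Gamma> c \<rho> {0<..<T} f g u \<longrightarrow>
        layered_problem X N \<Gamma> c \<rho> {0<..<T} f g v \<longrightarrow>
        (\<forall>j\<in>{1..N}. \<forall>x\<in>layer N \<Gamma> j. \<forall>t\<in>{0<..<T}. u j x t = v j x t)"
    using X unfolding uniqueness_class_def by (elim conjE)
  from this[rule_format, OF assms(1-5)] show ?thesis using assms by simp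
qed

lemma closed_interface: "j \<in> {1..N-1} \<Longrightarrow> closed (\<Gamma> j)"
  using geometry unfolding layered_geometry_def lipschitz_interface_def by blast

lemma interface_order:
  assumes "i \<in> {1..N-1}" "j \<in> {1..N-1}" "i < j"
  shows "\<Gamma> j \<subseteq> lower_domain (\<Gamma> i)" "\<Gamma> i \<subseteq> upper_domain (\<Gamma> j)"
proof -
  obtain h where "\<forall>j\<in>{1..N-1}. lipschitz_interface (h j) (\<Gamma> j)"
    and "\<forall>i\<in>{1..N-1}. \<forall>j\<in>{1..N-1}. i < j \<longrightarrow> h j < h i"
    using geometry unfolding layered_geometry_def by (elim conjE exE)
  then have h: "lipschitz_interface (h i) (\<Gamma> i)" "lipschitz_interface (h j) (\<Gamma> j)" "h j < h i"
    using assms by simp_all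
  have "\<Gamma> i \<inter> \<Gamma> j = {}" "\<Gamma> j \<inter> \<Gamma> i = {}"
    using geometry assms unfolding layered_geometry_def by force+
  then show "\<Gamma> j \<subseteq> lower_domain (\<Gamma> i)" "\<Gamma> i \<subseteq> upper_domain (\<Gamma> j)"
    using interface_below[OF h(1,2) _ h(3)] interface_above[OF h(2,1) _ h(3)] by simp_all
qed

lemma lower_neighbour: "j \<in> {1..N} \<Longrightarrow> j \<noteq> 1 \<Longrightarrow> \<exists>i\<in>{1..N-1}. j = Suc i"
  by (intro bexI[of _ "j - 1"]) auto

lemma open_layer: "j \<in> {1..N} \<Longrightarrow> open (layer N \<Gamma> j)"
  unfolding layer_def
  by (intro open_Int) (auto intro!: open_lower_domain open_upper_domain closed_interface)

lemma layer_subset: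
  "j \<in> {1..N-1} \<Longrightarrow> layer N \<Gamma> j \<subseteq> upper_domain (\<Gamma> j)"
  "j \<in> {1..N-1} \<Longrightarrow> layer N \<Gamma> (Suc j) \<subseteq> lower_domain (\<Gamma> j)"
  by (auto simp: layer_def)

lemma layered_problem_add:
  assumes J: "open J"
    and u: "layered_problem X N \<Gamma> c \<rho> J f g u" and v: "layered_problem X N \<Gamma> c \<rho> J f' g' v"
  shows "layered_problem X N \<Gamma> c \<rho> J (\<lambda>j x t. f j x t + f' j x t) (\<lambda>j x t. g j x t + g' j x t)
    (\<lambda>j x t. u j x t + v j x t)"
proof -
  have ivp: "wave_ivp X (layer N \<Gamma> j) J (c j) (u j)" "wave_ivp X (layer N \<Gamma> j) J (c j) (v j)"
    if "j \<in> {1..N}" for j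
    using that u v by (simp_all add: layered_problem_def)
  have diff: "(\<lambda>z. u j z t) differentiable (at y) \<and> (\<lambda>z. v j z t) differentiable (at y)"
    if "j \<in> {1..N}" "y \<in> layer N \<Gamma> j" "t \<in> J" for j y t
    using ivp[OF that(1)] space_slice_differentiable[OF open_layer[OF that(1)] J _ that(2,3)]
    by (simp add: wave_ivp_def)
  show ?thesis
    unfolding layered_problem_def
  proof (intro conjI ballI)
    show "wave_ivp X (layer N \<Gamma> j) J (c j) (\<lambda>x t. u j x t + v j x t)" if "j \<in> {1..N}" for j
      using wave_ivp_add[OF open_layer[OF that] J X_add ivp[OF that]] .
    show "transmission_conditions (\<Gamma> j) J (layer N \<Gamma> j) (\<rho> j) (\<lambda>x t. u j x t + v j x t)
        (layer N \<Gamma> (j + 1)) (\<rho> (j + 1)) (\<lambda>x t. u (j + 1) x t + v (j + 1) x t)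
        (\<lambda>x t. f j x t + f' j x t) (\<lambda>x t. g j x t + g' j x t)" if "j \<in> {1..N-1}" for j
      using u v that by (intro transmission_conditions_add diff) (auto simp: layered_problem_def)
  qed
qed

lemma layered_problem_subset:
  assumes u: "layered_problem X N \<Gamma> c \<rho> J f g u" and J': "J' \<subseteq> J"
    and data: "\<And>j x t. j \<in> {1..N-1} \<Longrightarrow> x \<in> \<Gamma> j \<Longrightarrow> t \<in> J' \<Longrightarrow> f j x t = f' j x t \<and> g j x t = g' j x t"
  shows "layered_problem X N \<Gamma> c \<rho> J' f' g' u"
  unfolding layered_problem_def
proof (intro conjI ballI)
  show "wave_ivp X (layer N \<Gamma> j) J' (c j) (u j)" if "j \<in> {1..N}" for j
    by (rule wave_ivp_subset[OF _ order_refl order_refl J']) (use u that in \<open>simp add: layered_problem_def\<close>)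
  show "transmission_conditions (\<Gamma> j) J' (layer N \<Gamma> j) (\<rho> j) (u j) (layer N \<Gamma> (j + 1)) (\<rho> (j + 1))
      (u (j + 1)) (f' j) (g' j)" if j: "j \<in> {1..N-1}" for j
  proof (rule transmission_conditions_subset[OF _ J' order_refl order_refl _ data[OF j]])
    show "transmission_conditions (\<Gamma> j) J (layer N \<Gamma> j) (\<rho> j) (u j) (layer N \<Gamma> (j + 1)) (\<rho> (j + 1))
      (u (j + 1)) (f j) (g j)" using u j by (simp add: layered_problem_def)
    show "x \<notin> layer N \<Gamma> j \<and> x \<notin> layer N \<Gamma> (j + 1)" if "x \<in> \<Gamma> j" for x
      using layer_subset[OF j] upper_domain_disjoint[OF that] lower_domain_disjoint[OF that] by auto
  qed
qed

text \<open>Up to the time \<open>T\<close>, the zero function solves the same problem.\<close>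

lemma two_layered_vanishes:
  assumes T: "T > 0" and j: "j \<in> {1..N-1}"
    and u: "two_layered_problem X \<Gamma> c \<rho> j {0<..} f g ua ub"
    and data: "\<And>x t. x \<in> \<Gamma> j \<Longrightarrow> 0 < t \<Longrightarrow> t < T \<Longrightarrow> f x t = 0 \<and> g x t = 0"
  shows "x \<in> upper_domain (\<Gamma> j) \<Longrightarrow> 0 < t \<Longrightarrow> t < T \<Longrightarrow> ua x t = 0"
    and "x \<in> lower_domain (\<Gamma> j) \<Longrightarrow> 0 < t \<Longrightarrow> t < T \<Longrightarrow> ub x t = 0"
proof -
  have 1: "two_layered_problem X \<Gamma> c \<rho> j {0<..<T} f g ua ub"
    by (rule two_layered_problem_subset[OF u]) auto
  have 2: "two_layered_problem X \<Gamma> c \<rho> j {0<..<T} f g (\<lambda>x t. 0) (\<lambda>x t. 0)"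
    unfolding two_layered_problem_def
    by (intro conjI wave_ivp_zero X_zero transmission_conditions_zero) (use data in auto)
  have *: "(\<forall>x\<in>upper_domain (\<Gamma> j). \<forall>t\<in>{0<..<T}. ua x t = 0) \<and>
        (\<forall>x\<in>lower_domain (\<Gamma> j). \<forall>t\<in>{0<..<T}. ub x t = 0)"
    using X T j 1 2 unfolding uniqueness_class_def by blast
  show "x \<in> upper_domain (\<Gamma> j) \<Longrightarrow> 0 < t \<Longrightarrow> t < T \<Longrightarrow> ua x t = 0"
    "x \<in> lower_domain (\<Gamma> j) \<Longrightarrow> 0 < t \<Longrightarrow> t < T \<Longrightarrow> ub x t = 0"
    using * by auto
qed

definition min_crossing_time :: real where
  "min_crossing_time = Min ((\<lambda>j. setdist (\<Gamma> j) (\<Gamma> (j+1)) / c (j+1)) ` {1..N-2})"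

lemma min_crossing_time_le:
  "j \<in> {1..N-2} \<Longrightarrow> min_crossing_time \<le> setdist (\<Gamma> j) (\<Gamma> (Suc j)) / c (Suc j)"
  unfolding min_crossing_time_def by (intro Min_le) auto

lemma setdist_pos: "j \<in> {1..N-2} \<Longrightarrow> setdist (\<Gamma> j) (\<Gamma> (Suc j)) > 0"
  using geometry unfolding layered_geometry_def by simp

lemma min_crossing_time_pos: "min_crossing_time > 0"
  unfolding min_crossing_time_def
  using N setdist_pos c_pos by (subst Min_gr_iff) (auto intro!: divide_pos_pos)

end

section \<open>Multiple scattering\<close>

locale scattering = multilayer +
  fixes f g :: "nat \<Rightarrow> plane \<Rightarrow> real \<Rightarrow> real" and up um :: "nat \<Rightarrow> nat \<Rightarrow> plane \<Rightarrow> real \<Rightarrow> real" and t\<^sub>0 :: real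
  assumes t0: "t\<^sub>0 > 0"
    and data_zero: "j \<in> {1..N-1} \<Longrightarrow> x \<in> \<Gamma> j \<Longrightarrow> 0 < t \<Longrightarrow> t \<le> t\<^sub>0 \<Longrightarrow> f j x t = 0 \<and> g j x t = 0"
    and iterates: "multiple_scattering X N \<Gamma> c \<rho> f g up um"
begin

abbreviation "F \<equiv> iterate_f N f up um"
abbreviation "G \<equiv> iterate_g N \<Gamma> \<rho> g up um"

lemma iterate:
  assumes "m \<ge> 1" "j \<in> {1..N-1}"
  shows "two_layered_problem X \<Gamma> c \<rho> j {0<..} (F j m) (G j m) (up j m) (um (Suc j) m)"
  using iterates assms unfolding multiple_scattering_def by simp

lemma iterate_up: "m \<ge> 1 \<Longrightarrow> j \<in> {1..N-1} \<Longrightarrow> wave_ivp X (upper_domain (\<Gamma> j)) {0<..} (c j) (up j m)"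
  and iterate_um: "m \<ge> 1 \<Longrightarrow> j \<in> {1..N-1} \<Longrightarrow> wave_ivp X (lower_domain (\<Gamma> j)) {0<..} (c (Suc j)) (um (Suc j) m)"
  using iterate unfolding two_layered_problem_def by auto

text \<open>The data of order \<open>m + 1\<close> on \<open>\<Gamma> j\<close> are values and normal derivatives of waves that start at a
  neighbouring interface not before the data of order \<open>m\<close>, and that have to cross a layer to reach
  \<open>\<Gamma> j\<close>.\<close>

lemma iterate_data_vanish:
  assumes "m \<ge> 1" "j \<in> {1..N-1}" "x \<in> \<Gamma> j" "0 < t" "t < t\<^sub>0 + (real m - 1) * min_crossing_time"
  shows "F j m x t = 0 \<and> G j m x t = 0"
  using assms
proof (induction m arbitrary: j x t rule: nat_induct_at_least)
  case base
  then show ?case using data_zero[of j x t] by (simp add: iterate_f_def iterate_g_def)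
next
  case (Suc m)
  define \<tau> where "\<tau> = t\<^sub>0 + (real m - 1) * min_crossing_time"
  have \<tau>: "\<tau> > 0"
    using t0 min_crossing_time_pos Suc.hyps by (simp add: \<tau>_def add_pos_nonneg)
  have t: "t < \<tau> + min_crossing_time"
    using Suc.prems(4) by (simp add: \<tau>_def algebra_simps)
  have IH: "F i m y s = 0 \<and> G i m y s = 0" if "i \<in> {1..N-1}" "y \<in> \<Gamma> i" "0 < s" "s < \<tau>" for i y s
    using Suc.IH that by (simp add: \<tau>_def)
  have up_zero: "up i m y s = 0" if "i \<in> {1..N-1}" "y \<in> upper_domain (\<Gamma> i)" "0 < s" "s < \<tau>" for i y s
    using two_layered_vanishes(1)[OF \<tau> that(1) iterate[OF Suc.hyps that(1)] IH[OF that(1)] that(2-4)] .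
  have um_zero: "um (Suc i) m y s = 0" if "i \<in> {1..N-1}" "y \<in> lower_domain (\<Gamma> i)" "0 < s" "s < \<tau>" for i y s
    using two_layered_vanishes(2)[OF \<tau> that(1) iterate[OF Suc.hyps that(1)] IH[OF that(1)] that(2-4)] .
  have um: "um j m x t = 0 \<and> normal_deriv (\<Gamma> j) (um j m) x t = 0" if "j \<noteq> 1"
  proof -
    obtain i where i: "j = Suc i" "i \<in> {1..N-2}" "i \<in> {1..N-1}"
      using \<open>j \<noteq> 1\<close> Suc.prems(1) by (cases j) auto
    have sub: "ball x (setdist (\<Gamma> i) (\<Gamma> j)) \<subseteq> lower_domain (\<Gamma> i)"
      using ball_subset_lower_domain[OF interface_order(1)[OF i(3) Suc.prems(1)] Suc.prems(2)]
        setdist_pos[OF i(2)] i(1) by simp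
    have cj: "c j > 0" and d: "setdist (\<Gamma> i) (\<Gamma> j) > 0"
      using c_pos Suc.prems(1) setdist_pos[OF i(2)] i(1) by auto
    have um_ivp: "wave_ivp X (lower_domain (\<Gamma> i)) {0<..} (c j) (um j m)"
      using iterate_um[OF Suc.hyps i(3)] i(1) by simp
    have "t < \<tau> + setdist (\<Gamma> i) (\<Gamma> j) / c j"
      using t min_crossing_time_le[OF i(2)] i(1) by simp
    then show ?thesis
      using finite_propagation_speed_gradient[OF cj d \<tau> sub um_ivp um_zero[OF i(3), folded i(1)] Suc.prems(3)]
      by (simp add: normal_deriv_def)
  qed
  have up: "up (Suc j) m x t = 0 \<and> normal_deriv (\<Gamma> j) (up (Suc j) m) x t = 0" if "Suc j \<noteq> N"
  proof -
    have i: "Suc j \<in> {1..N-1}" "j \<in> {1..N-2}"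
      using that Suc.prems(1) by auto
    have sub: "ball x (setdist (\<Gamma> j) (\<Gamma> (Suc j))) \<subseteq> upper_domain (\<Gamma> (Suc j))"
      using ball_subset_upper_domain[OF interface_order(2)[OF Suc.prems(1) i(1)] Suc.prems(2)]
        setdist_pos[OF i(2)] by simp
    have cj: "c (Suc j) > 0" using c_pos i by auto
    have "t < \<tau> + setdist (\<Gamma> j) (\<Gamma> (Suc j)) / c (Suc j)"
      using t min_crossing_time_le[OF i(2)] by simp
    then show ?thesis
      using finite_propagation_speed_gradient[OF cj setdist_pos[OF i(2)] \<tau> sub
          iterate_up[OF Suc.hyps i(1)] up_zero[OF i(1)] Suc.prems(3)]
      by (simp add: normal_deriv_def)
  qed
  show ?case
    using um up Suc.hyps by (simp add: iterate_f_def iterate_g_def)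
qed

lemma iterate_1: "F j 1 x t = f j x t" "G j 1 x t = g j x t"
  by (simp_all add: iterate_f_def iterate_g_def)

definition order_field :: "nat \<Rightarrow> nat \<Rightarrow> plane \<Rightarrow> real \<Rightarrow> real" where
  "order_field m j x t = (if j = 1 then 0 else um j m x t) + (if j = N then 0 else up j m x t)"

text \<open>On both sides of \<open>\<Gamma> j\<close>, the field is the sum of a wave scattered at \<open>\<Gamma> j\<close> itself, with jump given
  by the data of order \<open>m\<close>, and a wave from the neighbouring interface, smooth near \<open>\<Gamma> j\<close>. The jump of
  the latter is compensated by the next order.\<close>

lemma order_field_layered_problem:
  assumes m: "m \<ge> 1"
  shows "layered_problem X N \<Gamma> c \<rho> {0<..} (\<lambda>j x t. F j m x t - F j (Suc m) x t)
    (\<lambda>j x t. G j m x t - G j (Suc m) x t) (order_field m)"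
proof -
  \<comment> \<open>The wave coming down from the upper boundary of a layer, and the one going up from its lower
    boundary; zero in the outermost layers, where there is none.\<close>
  define dn where "dn j = (if j = 1 then \<lambda>x t. 0 else um j m)" for j
  define ups where "ups j = (if j = N then \<lambda>x t. 0 else up j m)" for j
  have dn: "wave_ivp X (layer N \<Gamma> j) {0<..} (c j) (dn j)" if jN: "j \<in> {1..N}" for j
  proof (cases "j = 1")
    case False
    obtain i where i: "j = Suc i" "i \<in> {1..N-1}" using lower_neighbour[OF jN False] by blast
    show ?thesis
      using wave_ivp_subset[OF iterate_um[OF m i(2)] layer_subset(2)[OF i(2)] X_restrict(2)[OF i(2)] order_refl]
      by (simp add: i(1) dn_def False[unfolded i(1)] del: One_nat_def)
  qed (simp add: dn_def wave_ivp_zero X_zero)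
  have ups: "wave_ivp X (layer N \<Gamma> j) {0<..} (c j) (ups j)" if "j \<in> {1..N}" for j
  proof (cases "j = N")
    case False
    then have j: "j \<in> {1..N-1}" using that by auto
    show ?thesis
      using wave_ivp_subset[OF iterate_up[OF m j] layer_subset(1)[OF j] X_restrict(1)[OF j] order_refl]
      by (simp add: ups_def False)
  qed (simp add: ups_def wave_ivp_zero X_zero)
  have field: "order_field m j = (\<lambda>x t. dn j x t + ups j x t)" for j
    by (auto simp: order_field_def dn_def ups_def fun_eq_iff)
  have J: "open {0::real<..}" by simp
  have diff: "(\<lambda>z. dn j z t) differentiable (at y)" "(\<lambda>z. ups j z t) differentiable (at y)"
    if "j \<in> {1..N}" "y \<in> layer N \<Gamma> j" "t \<in> {0<..}" for j y t
    using dn[OF that(1)] ups[OF that(1)] space_slice_differentiable[OF open_layer[OF that(1)] J _ that(2,3)]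
    by (simp_all add: wave_ivp_def)
  show ?thesis
    unfolding layered_problem_def field
  proof (intro conjI ballI)
    show "wave_ivp X (layer N \<Gamma> j) {0<..} (c j) (\<lambda>x t. dn j x t + ups j x t)" if "j \<in> {1..N}" for j
      by (rule wave_ivp_add[OF open_layer[OF that] J X_add dn[OF that] ups[OF that]])
    fix j assume j: "j \<in> {1..N-1}"
    then have jN: "j \<in> {1..N}" by auto
    \<comment> \<open>The waves scattered at \<open>\<Gamma> j\<close> keep their jump when they are restricted to the adjacent layers.\<close>
    have near: "transmission_conditions (\<Gamma> j) {0<..} (layer N \<Gamma> j) (\<rho> j) (ups j)
        (layer N \<Gamma> (j + 1)) (\<rho> (j + 1)) (dn (j + 1)) (F j m) (G j m)"
    proof (rule transmission_conditions_subset[OF _ order_refl])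
      show "transmission_conditions (\<Gamma> j) {0<..} (upper_domain (\<Gamma> j)) (\<rho> j) (ups j)
          (lower_domain (\<Gamma> j)) (\<rho> (j + 1)) (dn (j + 1)) (F j m) (G j m)"
        using iterate[OF m j] j by (auto simp: two_layered_problem_def ups_def dn_def)
    qed (use j layer_subset upper_domain_disjoint lower_domain_disjoint in auto)
    \<comment> \<open>The waves from the interfaces above and below are solutions on a whole neighbourhood of \<open>\<Gamma> j\<close>.\<close>
    have "\<exists>E. open E \<and> \<Gamma> j \<subseteq> E \<and> Ck_on 2 (E \<times> {0<..}) (spacetime (dn j))"
    proof (cases "j = 1")
      case True
      then show ?thesis by (intro exI[of _ UNIV]) (simp add: dn_def Ck_on_zero)
    next
      case False
      obtain i where i: "j = Suc i" "i \<in> {1..N-1}" using lower_neighbour[OF jN False] by blast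
      then show ?thesis
        using iterate_um[OF m i(2)] interface_order(1)[OF i(2) j] False
        by (intro exI[of _ "lower_domain (\<Gamma> i)"])
          (auto simp: dn_def wave_ivp_def intro!: open_lower_domain closed_interface)
    qed
    moreover have "\<exists>E. open E \<and> \<Gamma> j \<subseteq> E \<and> Ck_on 2 (E \<times> {0<..}) (spacetime (ups (j + 1)))"
    proof (cases "j + 1 = N")
      case True
      then show ?thesis by (intro exI[of _ UNIV]) (simp add: ups_def Ck_on_zero)
    next
      case False
      then have i: "j + 1 \<in> {1..N-1}" using j by auto
      then show ?thesis
        using iterate_up[OF m i] interface_order(2)[OF j i] False
        by (intro exI[of _ "upper_domain (\<Gamma> (j + 1))"])
          (auto simp: ups_def wave_ivp_def intro!: open_upper_domain closed_interface)
    qed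
    ultimately have far: "transmission_conditions (\<Gamma> j) {0<..} (layer N \<Gamma> j) (\<rho> j) (dn j)
        (layer N \<Gamma> (j + 1)) (\<rho> (j + 1)) (ups (j + 1)) (\<lambda>x t. ups (j + 1) x t - dn j x t)
        (\<lambda>x t. normal_deriv (\<Gamma> j) (ups (j + 1)) x t / \<rho> (j + 1) - normal_deriv (\<Gamma> j) (dn j) x t / \<rho> j)"
      using transmission_conditions_smooth[OF _ _ _ _ _ _ J] by blast
    have "F j m x t - F j (Suc m) x t = F j m x t + (ups (j + 1) x t - dn j x t)"
      "G j m x t - G j (Suc m) x t = G j m x t + (normal_deriv (\<Gamma> j) (ups (j + 1)) x t / \<rho> (j + 1)
        - normal_deriv (\<Gamma> j) (dn j) x t / \<rho> j)" for x t
      using m by (auto simp: iterate_f_def iterate_g_def ups_def dn_def normal_deriv_def)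
    moreover have "transmission_conditions (\<Gamma> j) {0<..} (layer N \<Gamma> j) (\<rho> j) (\<lambda>x t. ups j x t + dn j x t)
        (layer N \<Gamma> (j + 1)) (\<rho> (j + 1)) (\<lambda>x t. dn (j + 1) x t + ups (j + 1) x t)
        (\<lambda>x t. F j m x t + (ups (j + 1) x t - dn j x t))
        (\<lambda>x t. G j m x t + (normal_deriv (\<Gamma> j) (ups (j + 1)) x t / \<rho> (j + 1)
          - normal_deriv (\<Gamma> j) (dn j) x t / \<rho> j))"
      by (rule transmission_conditions_add[OF near far]) (use j diff in auto)
    ultimately show "transmission_conditions (\<Gamma> j) {0<..} (layer N \<Gamma> j) (\<rho> j) (\<lambda>x t. dn j x t + ups j x t)
        (layer N \<Gamma> (j + 1)) (\<rho> (j + 1)) (\<lambda>x t. dn (j + 1) x t + ups (j + 1) x t)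
        (\<lambda>x t. F j m x t - F j (Suc m) x t) (\<lambda>x t. G j m x t - G j (Suc m) x t)"
      by (simp only: add.commute[of "ups j _ _"])
  qed
qed

text \<open>Each further order replaces the error in the data, the next data of the iteration, by the one after it.\<close>

lemma scattering_sum_layered_problem:
  assumes "M \<ge> 1"
  shows "layered_problem X N \<Gamma> c \<rho> {0<..} (\<lambda>j x t. f j x t - F j (Suc M) x t)
    (\<lambda>j x t. g j x t - G j (Suc M) x t) (scattering_sum N up um M)"
  using assms
proof (induction M rule: nat_induct_at_least)
  case base
  have "scattering_sum N up um 1 = order_field 1"
    by (auto simp: fun_eq_iff scattering_sum_def order_field_def)
  then show ?case
    using order_field_layered_problem[of 1] by (simp only: iterate_1 order_refl)
next
  case (Suc M)
  have "scattering_sum N up um (Suc M) = (\<lambda>j x t. scattering_sum N up um M j x t + order_field (Suc M) j x t)"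
    by (auto simp: fun_eq_iff scattering_sum_def order_field_def)
  then show ?case
    using layered_problem_add[OF _ Suc.IH order_field_layered_problem[of "Suc M"]] by simp
qed

lemma scattering_sum_eq_before:
  assumes M: "M \<ge> 1" and u: "layered_problem X N \<Gamma> c \<rho> {0<..} f g u"
    and j: "j \<in> {1..N}" "x \<in> layer N \<Gamma> j" and t: "0 < t" "t < t\<^sub>0 + real M * min_crossing_time"
  shows "u j x t = scattering_sum N up um M j x t"
proof -
  let ?T = "t\<^sub>0 + real M * min_crossing_time"
  have "layered_problem X N \<Gamma> c \<rho> {0<..<?T} f g u"
    by (rule layered_problem_subset[OF u]) auto
  moreover have "layered_problem X N \<Gamma> c \<rho> {0<..<?T} f g (scattering_sum N up um M)"
    by (rule layered_problem_subset[OF scattering_sum_layered_problem[OF M]])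
      (use iterate_data_vanish[of "Suc M"] in auto)
  moreover have "?T > 0" using t by simp
  ultimately show ?thesis
    using layered_problem_unique j t by blast
qed

lemma layered_problem_continuous_in_time:
  assumes "layered_problem X N \<Gamma> c \<rho> {0<..} f' g' v" "j \<in> {1..N}" "x \<in> layer N \<Gamma> j" "t > 0"
  shows "isCont (v j x) t"
proof -
  have "Ck_on 2 (layer N \<Gamma> j \<times> {0<..}) (spacetime (v j))"
    using assms by (simp add: layered_problem_def wave_ivp_def)
  from time_slice_derivative[OF open_layer[OF assms(2)] _ this assms(3)] show ?thesis
    using assms(4) by (auto intro: DERIV_isCont)
qed

lemma scattering_sum_eq:
  assumes M: "M \<ge> 1" and u: "layered_problem X N \<Gamma> c \<rho> {0<..} f g u"
    and j: "j \<in> {1..N}" "x \<in> layer N \<Gamma> j" and t: "0 \<le> t" "t \<le> validity_time N \<Gamma> c t\<^sub>0 M"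
  shows "u j x t = scattering_sum N up um M j x t"
proof -
  let ?s = "scattering_sum N up um M"
  have T: "validity_time N \<Gamma> c t\<^sub>0 M = t\<^sub>0 + real M * min_crossing_time"
    by (simp add: validity_time_def min_crossing_time_def)
  note s = scattering_sum_layered_problem[OF M]
  consider "t = 0" | "0 < t" "t < t\<^sub>0 + real M * min_crossing_time" | "t = t\<^sub>0 + real M * min_crossing_time" "t > 0"
    using t T by linarith
  then show ?thesis
  proof cases
    case 1
    then show ?thesis using u s j by (simp add: layered_problem_def wave_ivp_def)
  next
    case 2
    then show ?thesis using scattering_sum_eq_before[OF M u j] by simp
  next
    case 3
    have lim: "(u j x \<longlongrightarrow> u j x t) (at_left t)" "(?s j x \<longlongrightarrow> ?s j x t) (at_left t)"
      using layered_problem_continuous_in_time[OF u j 3(2)] layered_problem_continuous_in_time[OF s j 3(2)]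
      by (auto simp: isCont_def intro: tendsto_within_subset)
    have "\<forall>\<^sub>F s in at_left t. u j x s = ?s j x s"
      using eventually_at_left_real[OF 3(2)]
      by eventually_elim (use scattering_sum_eq_before[OF M u j] 3(1) in auto)
    then have "(?s j x \<longlongrightarrow> u j x t) (at_left t)"
      using lim(1) by (rule Lim_transform_eventually[rotated])
    then show ?thesis
      using lim(2) by (intro tendsto_unique[of "at_left t"]) auto
  qed
qed

end

theorem theorem3p6:
  fixes N M :: nat and \<Gamma> :: "nat \<Rightarrow> plane set" and c \<rho> :: "nat \<Rightarrow> real" and t\<^sub>0 :: real
    and X :: "plane set \<Rightarrow> (plane \<Rightarrow> real \<Rightarrow> real) set"
    and f g u :: "nat \<Rightarrow> plane \<Rightarrow> real \<Rightarrow> real"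
    and up um :: "nat \<Rightarrow> nat \<Rightarrow> plane \<Rightarrow> real \<Rightarrow> real"
  assumes "N \<ge> 3" and "M \<ge> 2"
    and "layered_geometry N \<Gamma>"
    and "\<And>j. j \<in> {1..N} \<Longrightarrow> c j > 0" and "\<And>j. j \<in> {1..N} \<Longrightarrow> \<rho> j > 0"
    and "t\<^sub>0 > 0"
    and "uniqueness_class N \<Gamma> c \<rho> X"
    and "incident_data N \<Gamma> c \<rho> f g"
    and "\<And>j x t. j \<in> {1..N-1} \<Longrightarrow> x \<in> \<Gamma> j \<Longrightarrow> 0 < t \<Longrightarrow> t \<le> t\<^sub>0 \<Longrightarrow> f j x t = 0 \<and> g j x t = 0"
    and "layered_problem X N \<Gamma> c \<rho> {0<..} f g u"
    and "multiple_scattering X N \<Gamma> c \<rho> f g up um"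
  shows "\<forall>j\<in>{1..N}. \<forall>x\<in>layer N \<Gamma> j. \<forall>t\<in>{0..validity_time N \<Gamma> c t\<^sub>0 M}.
           u j x t = scattering_sum N up um M j x t"
proof -
  interpret scattering N \<Gamma> c \<rho> X f g up um t\<^sub>0
    using assms by unfold_locales auto
  show ?thesis
    using scattering_sum_eq[of M u] assms by auto
qed

end
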